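(* Let $T>0$, let $\phi$ and $f_0$ satisfy assumptions (A1) and (A2) of the context, and let $f_t(x)$, $t\in[0,T]$, be the corresponding solution of $$\partial_t f_t(x)+\partial_x\left(f_t(x)\int_{\mathbb{R}}\phi(x,y)f_t(y)\,\mathrm{d}y\right)=0,\qquad f_t|_{t=0}=f_0,$$ with the regularity stated in the context. Assume that $f_t(x)>0$ for a.e. $(t,x)\in[0,T]\times\mathbb{R}$. Let $F_t(x)=\int_{-\infty}^x f_t(y)\,\mathrm{d}y$ and, for $\xi\in(0,1)$, define $$x(t,\xi)=x_t(\xi):=F_t^{-1}(\xi).$$ Then $x$ solves the continuum-limit equation $$\partial_t x(t,\xi)=\int_0^1\phi\big(x(t,\xi),x(t,z)\big)\,\mathrm{d}z\qquad\text{for a.e. }t\in[0,T].$$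
   Context: Assumptions. (A1) For some integer $k\ge1$, the initial datum satisfies $f_0\in H^k(\mathbb{R})\cap W^{1,1}(\mathbb{R})$, $f_0(x)\ge0$ for a.e. $x\in\mathbb{R}$, and $\|f_0\|_{L^1}=1$. (A2) The interaction function has the form $\phi(x,y)=\Phi'(x-y)$ with $\Phi'\in L^2(\mathbb{R})\cap L^\infty(\mathbb{R})$, and there exist $p\in[1,2]$, $h\in L^p(\mathbb{R})$ and $b\in\mathbb{R}$ such that $\Phi''=h+b\,\delta_0$ in the sense of distributions. Under (A1) and (A2), known theory provides for every $T>0$ a unique solution $f$ with $$f\in L^\infty([0,T];H^k(\mathbb{R})\cap W^{1,1}(\mathbb{R})),\quad \partial_t f\in L^\infty([0,T];H^{k-1}(\mathbb{R})),\quad f\ge 0\ \text{a.e.},\quad \|f_t\|_{L^1}=1\ \text{for a.e. } t.$$ The solution meant in the statement is this one, with its continuous representative. $F_t^{-1}$ is the quantile function $F_t^{-1}(\xi)=\inf\{x\in\mathbb{R}\mid F_t(x)\ge\xi\}$, which is the actual inverse of the strictly increasing function $F_t$ under the positivity assumption. *)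

theory Defs
  imports "HOL-Analysis.Analysis"
begin

section \<open>Lebesgue spaces on the real line\<close>

text \<open>Elements of function spaces are represented by functions; all notions below are invariant
  under modification on a null set.\<close>

definition Lp :: "real \<Rightarrow> (real \<Rightarrow> real) set" where
  "Lp p = {f \<in> borel_measurable lebesgue. integrable lebesgue (\<lambda>x. \<bar>f x\<bar> powr p)}"

definition Lp_norm :: "real \<Rightarrow> (real \<Rightarrow> real) \<Rightarrow> real" where
  "Lp_norm p f = (LINT x|lebesgue. \<bar>f x\<bar> powr p) powr (1 / p)"

definition Linfty :: "(real \<Rightarrow> real) set" where
  "Linfty = {f \<in> borel_measurable lebesgue. \<exists>C. AE x in lebesgue. \<bar>f x\<bar> \<le> C}"

definition locally_integrable :: "(real \<Rightarrow> real) \<Rightarrow> bool" where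
  "locally_integrable f \<longleftrightarrow> (\<forall>a b. f absolutely_integrable_on {a..b})"

section \<open>Distributions\<close>

definition test_functions :: "real set \<Rightarrow> (real \<Rightarrow> real) set" where
  "test_functions \<Omega> = {\<eta>. (\<forall>n x. ((deriv ^^ n) \<eta>) field_differentiable (at x)) \<and>
     (\<exists>K. compact K \<and> K \<subseteq> \<Omega> \<and> (\<forall>x. x \<notin> K \<longrightarrow> \<eta> x = 0))}"

text \<open>Distributions are given by their action on test functions; two of them are equal if they
  agree on \<open>test_functions UNIV\<close>.\<close>

type_synonym distribution = "(real \<Rightarrow> real) \<Rightarrow> real"

definition distr_of :: "(real \<Rightarrow> real) \<Rightarrow> distribution" where
  "distr_of f = (\<lambda>\<eta>. LINT x|lebesgue. f x * \<eta> x)"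

definition dirac :: "real \<Rightarrow> distribution" where
  "dirac a = (\<lambda>\<eta>. \<eta> a)"

definition distr_deriv :: "distribution \<Rightarrow> distribution" where
  "distr_deriv u = (\<lambda>\<eta>. - u (deriv \<eta>))"

definition has_weak_deriv :: "nat \<Rightarrow> (real \<Rightarrow> real) \<Rightarrow> (real \<Rightarrow> real) \<Rightarrow> bool" where
  "has_weak_deriv i f g \<longleftrightarrow> locally_integrable f \<and> locally_integrable g \<and>
     (\<forall>\<eta>\<in>test_functions UNIV. (distr_deriv ^^ i) (distr_of f) \<eta> = distr_of g \<eta>)"

section \<open>Sobolev spaces\<close>

text \<open>\<open>Sobolev k p\<close> is \<open>W\<^sup>k\<^sup>,\<^sup>p\<close>, and \<open>H\<^sup>k\<close> is \<open>Sobolev k 2\<close>.\<close>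

definition Sobolev :: "nat \<Rightarrow> real \<Rightarrow> (real \<Rightarrow> real) set" where
  "Sobolev k p = {f \<in> Lp p. \<forall>i\<le>k. \<exists>g \<in> Lp p. has_weak_deriv i f g}"

text \<open>Weak derivatives are unique up to null sets, so the choice does not affect the norm.\<close>

definition weak_deriv :: "real \<Rightarrow> nat \<Rightarrow> (real \<Rightarrow> real) \<Rightarrow> real \<Rightarrow> real" where
  "weak_deriv p i f = (SOME g. g \<in> Lp p \<and> has_weak_deriv i f g)"

definition Sobolev_norm :: "nat \<Rightarrow> real \<Rightarrow> (real \<Rightarrow> real) \<Rightarrow> real" where
  "Sobolev_norm k p f = (\<Sum>i\<le>k. Lp_norm p (weak_deriv p i f) powr p) powr (1 / p)"

section \<open>Bochner spaces and time derivatives\<close>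

text \<open>The space of \<open>L\<^sup>\<infinity>\<close> functions from \<open>[0, T]\<close> to the normed space of functions \<open>X\<close> with norm \<open>N\<close>:
  strongly measurable (almost everywhere a limit in norm of simple functions) and essentially
  bounded.\<close>

definition Linfty_Bochner ::
    "real \<Rightarrow> (real \<Rightarrow> real) set \<Rightarrow> ((real \<Rightarrow> real) \<Rightarrow> real) \<Rightarrow> (real \<Rightarrow> real \<Rightarrow> real) set" where
  "Linfty_Bochner T X N = {u.
     (AE t in lebesgue_on {0..T}. u t \<in> X) \<and>
     (\<exists>s :: nat \<Rightarrow> real \<Rightarrow> real \<Rightarrow> real.
        (\<forall>n. simple_function (lebesgue_on {0..T}) (s n) \<and> s n ` {0..T} \<subseteq> X) \<and>
        (AE t in lebesgue_on {0..T}. (\<lambda>n. N (\<lambda>x. u t x - s n t x)) \<longlonglongrightarrow> 0)) \<and>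
     (\<exists>C. AE t in lebesgue_on {0..T}. N (u t) \<le> C)}"

text \<open>\<open>g\<close> is the distributional time derivative of \<open>f\<close> on \<open>(0, T)\<close>. The vector-valued identity
  \<open>\<integral> \<eta>' f dt = - \<integral> \<eta> g dt\<close> is read as an equality of distributions in \<open>x\<close>, i.e. it is paired with
  every test function \<open>\<zeta>\<close> of \<open>x\<close>.\<close>

definition has_time_deriv ::
    "real \<Rightarrow> (real \<Rightarrow> real \<Rightarrow> real) \<Rightarrow> (real \<Rightarrow> real \<Rightarrow> real) \<Rightarrow> bool" where
  "has_time_deriv T f g \<longleftrightarrow>
     (\<forall>\<zeta>\<in>test_functions UNIV. \<forall>\<eta>\<in>test_functions {0<..<T}.
        (LINT t|lebesgue_on {0..T}. deriv \<eta> t * distr_of (f t) \<zeta>) =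
        - (LINT t|lebesgue_on {0..T}. \<eta> t * distr_of (g t) \<zeta>))"

section \<open>Assumptions and solutions\<close>

definition A1 :: "nat \<Rightarrow> (real \<Rightarrow> real) \<Rightarrow> bool" where
  "A1 k f0 \<longleftrightarrow> k \<ge> 1 \<and> f0 \<in> Sobolev k 2 \<inter> Sobolev 1 1 \<and>
     (AE x in lebesgue. 0 \<le> f0 x) \<and> Lp_norm 1 f0 = 1"

text \<open>\<open>\<Phi>'\<close> is the weak derivative of the potential \<open>\<Phi>\<close>; since it may jump at \<open>0\<close>, \<open>\<Phi>\<close> need not
  be differentiable everywhere.\<close>

definition A2 :: "(real \<Rightarrow> real \<Rightarrow> real) \<Rightarrow> bool" where
  "A2 \<phi> \<longleftrightarrow> (\<exists>\<Phi> \<Phi>'. has_weak_deriv 1 \<Phi> \<Phi>' \<and>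
     (\<forall>x y. \<phi> x y = \<Phi>' (x - y)) \<and> \<Phi>' \<in> Lp 2 \<inter> Linfty \<and>
     (\<exists>p h b. 1 \<le> p \<and> p \<le> 2 \<and> h \<in> Lp p \<and>
        (\<forall>\<eta>\<in>test_functions UNIV.
           (distr_deriv ^^ 2) (distr_of \<Phi>) \<eta> = distr_of h \<eta> + b * dirac 0 \<eta>)))"

definition velocity :: "(real \<Rightarrow> real \<Rightarrow> real) \<Rightarrow> (real \<Rightarrow> real) \<Rightarrow> real \<Rightarrow> real" where
  "velocity \<phi> \<rho> x = (LINT y|lebesgue. \<phi> x y * \<rho> y)"

text \<open>Since \<open>\<partial>\<^sub>t f\<close> is a function \<open>g\<close> of time with values in \<open>H\<^sup>k\<^sup>-\<^sup>1\<close>, the transport equation is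
  imposed for almost every \<open>t\<close> as an identity of distributions in \<open>x\<close>. The solution \<open>f\<close> is the
  representative that is jointly continuous in \<open>(t, x)\<close>, whereas \<open>f0\<close> is only given almost
  everywhere.\<close>

definition solution ::
    "nat \<Rightarrow> real \<Rightarrow> (real \<Rightarrow> real \<Rightarrow> real) \<Rightarrow> (real \<Rightarrow> real) \<Rightarrow> (real \<Rightarrow> real \<Rightarrow> real) \<Rightarrow> bool" where
  "solution k T \<phi> f0 f \<longleftrightarrow>
     continuous_on ({0..T} \<times> UNIV) (\<lambda>(t, x). f t x) \<and>
     f \<in> Linfty_Bochner T (Sobolev k 2 \<inter> Sobolev 1 1) (\<lambda>v. Sobolev_norm k 2 v + Sobolev_norm 1 1 v) \<and>
     (AE (t, x) in lebesgue_on ({0..T} \<times> UNIV). 0 \<le> f t x) \<and>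
     (AE t in lebesgue_on {0..T}. Lp_norm 1 (f t) = 1) \<and>
     (\<exists>g. g \<in> Linfty_Bochner T (Sobolev (k - 1) 2) (Sobolev_norm (k - 1) 2) \<and>
        has_time_deriv T f g \<and>
        (AE t in lebesgue_on {0..T}. \<forall>\<eta>\<in>test_functions UNIV.
           distr_of (g t) \<eta> + distr_deriv (distr_of (\<lambda>x. f t x * velocity \<phi> (f t) x)) \<eta> = 0)) \<and>
     (AE x in lebesgue. f 0 x = f0 x)"

definition cumulative :: "(real \<Rightarrow> real) \<Rightarrow> real \<Rightarrow> real" where
  "cumulative \<rho> x = (LINT y:{..x}|lebesgue. \<rho> y)"

definition quantile :: "(real \<Rightarrow> real) \<Rightarrow> real \<Rightarrow> real" where
  "quantile F \<xi> = Inf {x. F x \<ge> \<xi>}"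

end

theory Submission
  imports Defs "HOL-Probability.Probability"
begin

text \<open>
  Write \<open>\<phi> x y = \<Phi>' (x - y)\<close> and \<open>V t x = \<integral> \<Phi>' (x - y) f t y dy\<close>. Testing the equation with smooth
  approximations of the indicators of \<open>[s, t]\<close> and \<open>[a, b]\<close> turns it into the balance law
  \<open>\<integral>\<^sub>a\<^sup>b f t - \<integral>\<^sub>a\<^sup>b f s = \<integral>\<^sub>s\<^sup>t (f V)(r, a) - (f V)(r, b) dr\<close>. The flux through \<open>x\<close> is integrable in \<open>x\<close>,
  hence vanishes along sequences tending to \<open>\<plusminus>\<infinity>\<close>; so the mass is \<open>1\<close> at every time and, by Scheffe's
  lemma, \<open>V\<close> is jointly continuous. Therefore \<open>F\<close> is \<open>C\<^sup>1\<close> with \<open>\<partial>\<^sub>x F = f\<close> and \<open>\<partial>\<^sub>t F = - f V\<close>, and along a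
  line of slope \<open>v\<close> it has derivative \<open>f (v - V)\<close>.

  Since \<open>f\<close> may vanish at individual points, the implicit function theorem is not available.
  Instead, lines through \<open>(t, x t \<xi>)\<close> of slope slightly above or below \<open>V t (x t \<xi>)\<close> are barriers for
  the level curve \<open>F = \<xi>\<close>, which forces its derivative to be \<open>V t (x t \<xi>)\<close>. Finally, \<open>x t\<close> transports
  the Lebesgue measure on \<open>(0, 1)\<close> to \<open>f t y dy\<close>, which rewrites \<open>V\<close> as the integral over \<open>z\<close>.
\<close>

section \<open>Smooth cutoff functions\<close>

definition smooth :: "(real \<Rightarrow> real) \<Rightarrow> bool" where
  "smooth f \<longleftrightarrow> (\<forall>n x. ((deriv ^^ n) f) field_differentiable (at x))"

text \<open>Avoids any formula for the \<open>n\<close>-th derivative: it suffices to exhibit a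
  class of differentiable functions that is stable under \<open>deriv\<close>.\<close>

lemma smooth_coinduct:
  assumes "f \<in> S" "\<And>g x. g \<in> S \<Longrightarrow> g field_differentiable (at x)" "\<And>g. g \<in> S \<Longrightarrow> deriv g \<in> S"
  shows "smooth f"
proof -
  have "(deriv ^^ n) f \<in> S" for n
    by (induction n) (use assms in auto)
  then show ?thesis
    unfolding smooth_def using assms(2) by blast
qed

lemma smooth_field_differentiable: "smooth f \<Longrightarrow> f field_differentiable (at x)"
  unfolding smooth_def by (metis funpow_0)

lemma smooth_deriv: "smooth f \<Longrightarrow> smooth (deriv f)"
  unfolding smooth_def
proof (intro allI)
  fix n x assume "\<forall>n x. (deriv ^^ n) f field_differentiable at x"
  then have "(deriv ^^ Suc n) f field_differentiable at x" by blast
  then show "(deriv ^^ n) (deriv f) field_differentiable at x"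
    unfolding funpow_Suc_right by simp
qed

text \<open>The invariant class for \<open>smooth_coinduct\<close>: derivatives of sums, products,
  reciprocals and affine substitutions are again built by these rules, so composite functions need
  no higher Leibniz formula.\<close>

inductive_set smooth_closure :: "(real \<Rightarrow> real) set" where
  base: "smooth f \<Longrightarrow> f \<in> smooth_closure"
| add: "f \<in> smooth_closure \<Longrightarrow> g \<in> smooth_closure \<Longrightarrow> (\<lambda>x. f x + g x) \<in> smooth_closure"
| mult: "f \<in> smooth_closure \<Longrightarrow> g \<in> smooth_closure \<Longrightarrow> (\<lambda>x. f x * g x) \<in> smooth_closure"
| inverse: "f \<in> smooth_closure \<Longrightarrow> (\<And>x. f x \<noteq> 0) \<Longrightarrow> (\<lambda>x. inverse (f x)) \<in> smooth_closure"
| affine: "f \<in> smooth_closure \<Longrightarrow> (\<lambda>x. f (c * x + d)) \<in> smooth_closure"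

lemma smooth_const: "smooth (\<lambda>x. c)"
  by (rule smooth_coinduct[of _ "range (\<lambda>c x. c)"]) auto

lemma smooth_closure_DERIV:
  assumes "f \<in> smooth_closure"
  shows "\<exists>f'\<in>smooth_closure. \<forall>x. (f has_real_derivative f' x) (at x)"
  using assms
proof induction
  case (base f)
  then show ?case
    by (intro bexI[of _ "deriv f"])
      (auto intro: smooth_closure.base smooth_deriv smooth_field_differentiable
        simp: DERIV_deriv_iff_field_differentiable)
next
  case (add f g)
  then obtain f' g' where "f' \<in> smooth_closure" "g' \<in> smooth_closure"
    "\<forall>x. (f has_real_derivative f' x) (at x)" "\<forall>x. (g has_real_derivative g' x) (at x)" by blast
  then show ?case
    by (intro bexI[of _ "\<lambda>x. f' x + g' x"]) (auto intro!: derivative_intros smooth_closure.add)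
next
  case (mult f g)
  then obtain f' g' where "f' \<in> smooth_closure" "g' \<in> smooth_closure"
    "\<forall>x. (f has_real_derivative f' x) (at x)" "\<forall>x. (g has_real_derivative g' x) (at x)" by blast
  with mult show ?case
    by (intro bexI[of _ "\<lambda>x. f x * g' x + f' x * g x"])
       (auto intro!: derivative_eq_intros smooth_closure.add smooth_closure.mult)
next
  case (inverse f)
  then obtain f' where f': "f' \<in> smooth_closure" "\<forall>x. (f has_real_derivative f' x) (at x)" by blast
  have "(\<lambda>x. inverse (f x)) \<in> smooth_closure"
    using inverse by (intro smooth_closure.inverse)
  \<comment> \<open>Negation is expressed as a product with the constant -1, since the closure has
    no rule of its own for it.\<close>
  then have "(\<lambda>x. - 1 * (inverse (f x) * f' x * inverse (f x))) \<in> smooth_closure"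
    using f' by (intro smooth_closure.mult) (auto intro: smooth_closure.base smooth_const)
  then show ?case
    using f' inverse.hyps
    by (intro bexI[of _ "\<lambda>x. - 1 * (inverse (f x) * f' x * inverse (f x))"])
       (auto intro!: derivative_eq_intros)
next
  case (affine f c d)
  then obtain f' where f': "f' \<in> smooth_closure" "\<forall>x. (f has_real_derivative f' x) (at x)" by blast
  have "((\<lambda>x. f (c * x + d)) has_real_derivative c * f' (c * x + d)) (at x)" for x
  proof -
    have "((\<lambda>x. c * x + d) has_real_derivative c) (at x)"
      by (auto intro!: derivative_eq_intros)
    with f'(2) show ?thesis
      using DERIV_chain2[of f "f' (c * x + d)" "\<lambda>x. c * x + d" x c UNIV] by (simp add: mult.commute)
  qed
  then show ?case
    using f' by (intro bexI[of _ "\<lambda>x. c * f' (c * x + d)"])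
      (auto intro!: smooth_closure.mult smooth_closure.base[OF smooth_const] smooth_closure.affine)
qed

lemma smooth_closure_smooth: "f \<in> smooth_closure \<Longrightarrow> smooth f"
proof (rule smooth_coinduct[of _ smooth_closure])
  fix g x assume "g \<in> smooth_closure"
  then obtain g' where g': "g' \<in> smooth_closure" "\<And>x. (g has_real_derivative g' x) (at x)"
    using smooth_closure_DERIV by blast
  from g'(2) show "g field_differentiable (at x)"
    by (auto simp: field_differentiable_def)
  from g'(2) have "deriv g = g'"
    by (auto intro: DERIV_imp_deriv)
  with g'(1) show "deriv g \<in> smooth_closure" by simp
qed

section \<open>The flat exponential and a smooth unit step\<close>

text \<open>All derivatives of the flat function exp(-1/x), extended by 0, have the form p(1/x)
  exp(-1/x). Keeping the polynomial as a parameter makes the family stable under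
  \<open>deriv\<close>.\<close>

definition flat_exp :: "real poly \<Rightarrow> real \<Rightarrow> real" where
  "flat_exp p x = (if x > 0 then poly p (inverse x) * exp (- inverse x) else 0)"

lemma poly_times_exp_minus_tendsto_0: "((\<lambda>y. poly p y * exp (- y)) \<longlongrightarrow> 0) at_top" for p :: "real poly"
proof -
  have "((\<lambda>y. \<Sum>i\<le>degree p. coeff p i * (y ^ i / exp y)) \<longlongrightarrow> (\<Sum>i\<le>degree p. coeff p i * 0)) at_top"
    by (intro tendsto_intros tendsto_power_div_exp_0)
  then show ?thesis
    by (simp add: poly_altdef exp_minus sum_distrib_right divide_inverse mult.assoc)
qed

text \<open>With y = 1/x and dy/dx = -y^2, the chain rule gives y^2 (p(y) - p'(y)) exp(-y), and
  \<open>[:0, 0, 1:]\<close> is y^2. At 0 the right difference quotient is y p(y) exp(-y) with y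
  tending to infinity.\<close>

lemma flat_exp_DERIV: "(flat_exp p has_real_derivative flat_exp ([:0, 0, 1:] * (p - pderiv p)) x) (at x)"
proof (cases x "0::real" rule: linorder_cases)
  case greater
  have "((\<lambda>x. poly p (inverse x) * exp (- inverse x)) has_real_derivative
      flat_exp ([:0, 0, 1:] * (p - pderiv p)) x) (at x)"
    using greater
    by (auto intro!: derivative_eq_intros simp: flat_exp_def field_simps power2_eq_square)
  moreover have "\<forall>\<^sub>F y in nhds x. flat_exp p y = poly p (inverse y) * exp (- inverse y)"
    using eventually_nhds_in_open[of "{0<..}" x] greater
    by (auto elim!: eventually_mono simp: flat_exp_def)
  ultimately show ?thesis
    by (simp add: DERIV_cong_ev)
next
  case less
  have "\<forall>\<^sub>F y in nhds x. flat_exp p y = 0"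
    using eventually_nhds_in_open[of "{..<0}" x] less
    by (auto elim!: eventually_mono simp: flat_exp_def)
  then show ?thesis
    using less by (simp add: DERIV_cong_ev[where g = "\<lambda>_. 0"] flat_exp_def)
next
  case equal
  have "((\<lambda>h. poly ([:0, 1:] * p) (inverse h) * exp (- inverse h)) \<longlongrightarrow> 0) (at_right 0)"
    using filterlim_compose[OF poly_times_exp_minus_tendsto_0 filterlim_inverse_at_top_right] .
  then have "((\<lambda>h. flat_exp p h / h) \<longlongrightarrow> 0) (at_right 0)"
    by (rule Lim_transform_eventually)
      (auto simp: eventually_at_filter flat_exp_def field_simps intro!: always_eventually)
  moreover have "((\<lambda>h. flat_exp p h / h) \<longlongrightarrow> 0) (at_left 0)"
    by (rule Lim_transform_eventually[OF tendsto_const])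
      (auto simp: eventually_at_filter flat_exp_def intro!: always_eventually)
  ultimately have "((\<lambda>h. flat_exp p h / h) \<longlongrightarrow> 0) (at 0)"
    by (rule filterlim_split_at[rotated])
  with equal show ?thesis
    by (simp add: DERIV_def flat_exp_def)
qed

lemma smooth_flat_exp: "smooth (flat_exp p)"
proof (rule smooth_coinduct[of _ "range flat_exp"])
  fix g x assume "g \<in> range flat_exp"
  then obtain q where q: "g = flat_exp q" by blast
  show "g field_differentiable at x"
    using flat_exp_DERIV unfolding q field_differentiable_def by blast
  have "deriv g = flat_exp ([:0, 0, 1:] * (q - pderiv q))"
    using flat_exp_DERIV unfolding q by (auto intro: DERIV_imp_deriv)
  then show "deriv g \<in> range flat_exp" by blast
qed auto

text \<open>The usual smooth transition from 0 to 1 across the unit interval. It is a product with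
  \<open>inverse\<close> so as to match the rules of \<open>smooth_closure\<close>.\<close>

definition unit_step :: "real \<Rightarrow> real" where
  "unit_step x = flat_exp 1 x * inverse (flat_exp 1 x + flat_exp 1 (1 - x))"

lemma flat_exp_1_nonneg: "0 \<le> flat_exp 1 x"
  by (simp add: flat_exp_def)

lemma flat_exp_1_pos: "0 < x \<Longrightarrow> 0 < flat_exp 1 x"
  by (simp add: flat_exp_def)

lemma flat_exp_1_eq_0: "x \<le> 0 \<Longrightarrow> flat_exp 1 x = 0"
  by (simp add: flat_exp_def)

text \<open>At least one of \<open>x\<close> and \<open>1 - x\<close> is positive.\<close>

lemma step_denominator_pos: "0 < flat_exp 1 x + flat_exp 1 (1 - x)"
  using flat_exp_1_pos[of x] flat_exp_1_pos[of "1 - x"] flat_exp_1_nonneg[of x] flat_exp_1_nonneg[of "1 - x"]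
  by linarith

lemma smooth_unit_step: "smooth unit_step"
proof (rule smooth_closure_smooth)
  have 1: "flat_exp 1 \<in> smooth_closure"
    by (rule smooth_closure.base[OF smooth_flat_exp])
  have "(\<lambda>x. flat_exp 1 (1 - x)) \<in> smooth_closure"
    using smooth_closure.affine[OF 1, of "-1" 1] by simp
  with 1 show "unit_step \<in> smooth_closure"
    unfolding unit_step_def[abs_def]
    by (intro smooth_closure.mult smooth_closure.inverse smooth_closure.add)
      (use step_denominator_pos in \<open>auto simp: less_le\<close>)
qed

lemma unit_step_eq_0: "x \<le> 0 \<Longrightarrow> unit_step x = 0"
  by (simp add: unit_step_def flat_exp_1_eq_0)

lemma unit_step_eq_1: "1 \<le> x \<Longrightarrow> unit_step x = 1"
  using flat_exp_1_pos[of x] by (simp add: unit_step_def flat_exp_1_eq_0)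

lemma unit_step_nonneg: "0 \<le> unit_step x"
  using step_denominator_pos[of x] flat_exp_1_nonneg[of x] by (simp add: unit_step_def)

lemma unit_step_le_1: "unit_step x \<le> 1"
  using step_denominator_pos[of x] flat_exp_1_nonneg[of "1 - x"]
  by (simp add: unit_step_def divide_inverse[symmetric])

lemma unit_step_DERIV: "(unit_step has_real_derivative deriv unit_step x) (at x)"
  using smooth_field_differentiable[OF smooth_unit_step] by (simp add: DERIV_deriv_iff_field_differentiable)

lemma continuous_on_deriv_unit_step: "continuous_on S (deriv unit_step)"
  by (intro continuous_at_imp_continuous_on ballI field_differentiable_imp_continuous_at
      smooth_field_differentiable smooth_deriv smooth_unit_step)

lemma deriv_unit_step_eq_0: "x \<notin> {0..1} \<Longrightarrow> deriv unit_step x = 0"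
proof -
  assume "x \<notin> {0..1}"
  then consider "x < 0" | "x > 1" by fastforce
  then have "\<exists>c. \<forall>\<^sub>F y in nhds x. unit_step y = c"
  proof cases
    case 1
    then show ?thesis
      using eventually_nhds_in_open[of "{..<0}" x]
      by (auto elim!: eventually_mono simp: unit_step_eq_0 intro!: exI[of _ 0])
  next
    case 2
    then show ?thesis
      using eventually_nhds_in_open[of "{1<..}" x]
      by (auto elim!: eventually_mono simp: unit_step_eq_1 intro!: exI[of _ 1])
  qed
  then show ?thesis
    using deriv_cong_ev[of unit_step "\<lambda>_. _" x x] by auto
qed

lemma deriv_unit_step_bounded: "\<exists>M. \<forall>x. \<bar>deriv unit_step x\<bar> \<le> M"
proof -
  have "compact (deriv unit_step ` {0..1})"
    by (intro compact_continuous_image continuous_on_deriv_unit_step) simp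
  then obtain M where M: "\<forall>y\<in>deriv unit_step ` {0..1}. norm y \<le> M"
    using compact_imp_bounded bounded_iff by blast
  have "\<bar>deriv unit_step x\<bar> \<le> max M 0" for x
    using M deriv_unit_step_eq_0[of x] by (cases "x \<in> {0..1}") (auto simp: le_max_iff_disj)
  then show ?thesis by blast
qed

text \<open>Total mass one, together with boundedness and support in the unit interval, makes the
  rescaled derivatives an approximate identity.\<close>

lemma deriv_unit_step_has_integral:
  "has_bochner_integral lborel (deriv unit_step) 1"
proof -
  have "has_bochner_integral lborel (\<lambda>x. indicator {0..1} x *\<^sub>R deriv unit_step x) (unit_step 1 - unit_step 0)"
  proof (rule has_bochner_integral_FTC_Icc)
    show "(unit_step has_vector_derivative deriv unit_step x) (at x within {0..1})" for x
      using unit_step_DERIV has_real_derivative_iff_has_vector_derivative has_vector_derivative_at_within by blast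
  qed (auto intro: continuous_on_deriv_unit_step)
  moreover have "(\<lambda>x. indicator {0..1} x *\<^sub>R deriv unit_step x) = deriv unit_step"
    using deriv_unit_step_eq_0 by (auto simp: indicator_def fun_eq_iff)
  ultimately show ?thesis
    by (simp add: unit_step_eq_0 unit_step_eq_1)
qed

section \<open>Smooth indicators of intervals\<close>

text \<open>For \<open>a \<le> b\<close> this approximates the indicator of \<open>{a..b}\<close>.
  Both transition layers have width 1/(n + 1) and lie to the right of their endpoints, so the
  derivative is a difference of two copies of one kernel.\<close>

definition bump :: "nat \<Rightarrow> real \<Rightarrow> real \<Rightarrow> real \<Rightarrow> real" where
  "bump n a b x = unit_step (real (Suc n) * (x - a)) - unit_step (real (Suc n) * (x - b))"

lemma smooth_bump: "smooth (bump n a b)"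
proof (rule smooth_closure_smooth)
  have 1: "(\<lambda>x. unit_step (real (Suc n) * x + - (real (Suc n) * c))) \<in> smooth_closure" for c
    by (rule smooth_closure.affine[OF smooth_closure.base[OF smooth_unit_step]])
  have "(\<lambda>x. unit_step (real (Suc n) * x + - (real (Suc n) * a)) +
      - 1 * unit_step (real (Suc n) * x + - (real (Suc n) * b))) \<in> smooth_closure"
    by (intro smooth_closure.add smooth_closure.mult 1 smooth_closure.base[OF smooth_const])
  then show "bump n a b \<in> smooth_closure"
    by (simp add: bump_def[abs_def] right_diff_distrib)
qed

lemma deriv_bump:
  "deriv (bump n a b) x = real (Suc n) * deriv unit_step (real (Suc n) * (x - a)) -
     real (Suc n) * deriv unit_step (real (Suc n) * (x - b))"
proof -
  have 1: "((\<lambda>x. unit_step (real (Suc n) * (x - c))) has_real_derivative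
      deriv unit_step (real (Suc n) * (x - c)) * real (Suc n)) (at x)" for c
    by (rule DERIV_chain2[OF unit_step_DERIV]) (auto intro!: derivative_eq_intros)
  show ?thesis
    unfolding bump_def[abs_def]
    by (rule DERIV_imp_deriv) (use DERIV_diff[OF 1[of a] 1[of b]] in \<open>simp add: mult.commute\<close>)
qed

lemma bump_eq_0:
  assumes "a \<le> b" "x \<notin> {a..b + 1 / real (Suc n)}"
  shows "bump n a b x = 0"
proof -
  consider "x < a" | "x > b + 1 / real (Suc n)"
    using assms by fastforce
  then show ?thesis
  proof cases
    case 1
    with assms have "real (Suc n) * (x - a) \<le> 0" "real (Suc n) * (x - b) \<le> 0"
      by (auto intro!: mult_nonneg_nonpos)
    then show ?thesis by (simp add: bump_def unit_step_eq_0 del: of_nat_Suc)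
  next
    case 2
    then have "1 \<le> real (Suc n) * (x - b)"
      by (auto simp: field_simps simp del: of_nat_Suc)
    moreover have "real (Suc n) * (x - b) \<le> real (Suc n) * (x - a)"
      using assms by (intro mult_left_mono) auto
    ultimately have "1 \<le> real (Suc n) * (x - b)" "1 \<le> real (Suc n) * (x - a)"
      by linarith+
    then show ?thesis by (simp add: bump_def unit_step_eq_1 del: of_nat_Suc)
  qed
qed

text \<open>A support bound free of \<open>n\<close>, as dominated convergence requires.\<close>

lemma bump_eq_0_outside:
  assumes "a \<le> b" "x \<notin> {a..b + 1}"
  shows "bump n a b x = 0"
proof (rule bump_eq_0[OF assms(1)])
  have "1 / real (Suc n) \<le> 1" by simp
  with assms(2) show "x \<notin> {a..b + 1 / real (Suc n)}"
    unfolding atLeastAtMost_iff by linarith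
qed

text \<open>The support is stated with its exact right layer, because in time it has to fit into
  \<open>{0<..<T}\<close>.\<close>

lemma bump_in_test_functions:
  assumes "a \<le> b" "{a..b + 1 / real (Suc n)} \<subseteq> \<Omega>"
  shows "bump n a b \<in> test_functions \<Omega>"
proof -
  have "\<forall>m x. ((deriv ^^ m) (bump n a b)) field_differentiable (at x)"
    using smooth_bump[of n a b] by (simp add: smooth_def)
  then show ?thesis
    unfolding test_functions_def using assms bump_eq_0[OF assms(1), of _ n]
    by (intro CollectI conjI exI[of _ "{a..b + 1 / real (Suc n)}"]) auto
qed

lemma continuous_on_smooth: "smooth f \<Longrightarrow> continuous_on S f"
  by (intro continuous_at_imp_continuous_on ballI field_differentiable_imp_continuous_at
      smooth_field_differentiable)

lemma borel_measurable_smooth: "smooth f \<Longrightarrow> f \<in> borel_measurable borel"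
  by (intro borel_measurable_continuous_onI continuous_on_smooth)

lemma abs_bump_le_1: "\<bar>bump n a b x\<bar> \<le> 1"
  using unit_step_nonneg[of "real (Suc n) * (x - a)"] unit_step_le_1[of "real (Suc n) * (x - a)"]
    unit_step_nonneg[of "real (Suc n) * (x - b)"] unit_step_le_1[of "real (Suc n) * (x - b)"]
  unfolding bump_def by linarith

lemma unit_step_scaled_tendsto:
  "(\<lambda>n. unit_step (real (Suc n) * (x - c))) \<longlonglongrightarrow> indicator {c<..} x"
proof (cases "x \<le> c")
  case True
  then have "unit_step (real (Suc n) * (x - c)) = 0" for n
    by (intro unit_step_eq_0 mult_nonneg_nonpos) auto
  with True show ?thesis by simp
next
  case False
  then obtain N where N: "1 / (x - c) < real N"
    using reals_Archimedean2 by blast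
  have "unit_step (real (Suc n) * (x - c)) = 1" if "n \<ge> N" for n
  proof (rule unit_step_eq_1)
    have "1 / (x - c) \<le> real (Suc n)" using N that by simp
    with False show "1 \<le> real (Suc n) * (x - c)" by (simp add: field_simps)
  qed
  then have "\<forall>\<^sub>F n in sequentially. unit_step (real (Suc n) * (x - c)) = 1"
    using eventually_sequentially by blast
  with False show ?thesis
    by (auto intro: tendsto_eventually)
qed

lemma integral_bump_tendsto:
  fixes g :: "real \<Rightarrow> real"
  assumes "a \<le> b" and g: "set_integrable lborel {a..b + 1} g"
    and [measurable]: "g \<in> borel_measurable lborel"
  shows "(\<lambda>n. LINT x|lborel. bump n a b x * g x) \<longlonglongrightarrow> (LINT x:{a..b}|lborel. g x)"
proof -
  have [measurable]: "bump n a b \<in> borel_measurable borel" for n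
    by (rule borel_measurable_smooth[OF smooth_bump])
  have "(\<lambda>n. LINT x|lborel. bump n a b x * g x) \<longlonglongrightarrow> (LINT x|lborel. indicator {a..b} x * g x)"
  proof (rule integral_dominated_convergence[where w = "\<lambda>x. \<bar>indicator {a..b + 1} x *\<^sub>R g x\<bar>"])
    show "integrable lborel (\<lambda>x. \<bar>indicator {a..b + 1} x *\<^sub>R g x\<bar>)"
      using g unfolding set_integrable_def by (rule integrable_abs)
    \<comment> \<open>As \<open>unit_step\<close> vanishes at 0, the pointwise limit is the
      indicator of \<open>{a<..b}\<close>; it differs from that of \<open>{a..b}\<close> at the null
      point \<open>a\<close> only.\<close>
    have "(\<lambda>n. bump n a b x * g x) \<longlonglongrightarrow> indicator {a..b} x * g x" if "x \<noteq> a" for x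
    proof -
      have "(\<lambda>n. bump n a b x * g x) \<longlonglongrightarrow> (indicator {a<..} x - indicator {b<..} x) * g x"
        unfolding bump_def by (intro tendsto_intros unit_step_scaled_tendsto)
      also have "(indicator {a<..} x - indicator {b<..} x) = (indicator {a..b} x :: real)"
        using that \<open>a \<le> b\<close> by (auto simp: indicator_def)
      finally show ?thesis .
    qed
    then show "AE x in lborel. (\<lambda>n. bump n a b x * g x) \<longlonglongrightarrow> indicator {a..b} x * g x"
      by (rule eventually_mono[OF AE_lborel_singleton[of a]])
    show "AE x in lborel. norm (bump n a b x * g x) \<le> \<bar>indicator {a..b + 1} x *\<^sub>R g x\<bar>" for n
    proof (intro always_eventually allI)
      fix x
      have "x \<notin> {a..b + 1} \<Longrightarrow> bump n a b x = 0"
        by (rule bump_eq_0_outside[OF \<open>a \<le> b\<close>])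
      then show "norm (bump n a b x * g x) \<le> \<bar>indicator {a..b + 1} x *\<^sub>R g x\<bar>"
        using abs_bump_le_1[of n a b x] by (auto simp: indicator_def abs_mult intro: mult_left_le_one_le)
    qed
  qed measurable
  then show ?thesis by (simp add: set_lebesgue_integral_def)
qed

section \<open>One-sided approximate identities\<close>

definition deriv_unit_step_bound :: real where
  "deriv_unit_step_bound = (SOME M. \<forall>x. \<bar>deriv unit_step x\<bar> \<le> M)"

lemma abs_deriv_unit_step_le: "\<bar>deriv unit_step x\<bar> \<le> deriv_unit_step_bound"
  using someI_ex[OF deriv_unit_step_bounded] unfolding deriv_unit_step_bound_def by blast

lemma deriv_unit_step_measurable: "deriv unit_step \<in> borel_measurable borel"
  by (intro borel_measurable_continuous_onI continuous_on_deriv_unit_step)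

context
  fixes g :: "real \<Rightarrow> real"
  assumes g: "continuous_on UNIV g"
begin

text \<open>In the rescaled variable the support is the unit interval for every \<open>n\<close>,
  and there the argument of \<open>g\<close> stays in \<open>{c..c + 1}\<close>. Hence one majorant
  serves all \<open>n\<close>.\<close>

lemma kernel_dominated:
  assumes "\<And>x. x \<in> {c..c + 1} \<Longrightarrow> \<bar>g x\<bar> \<le> K"
  shows "\<bar>deriv unit_step y * g (c + (1 / real (Suc n)) * y)\<bar> \<le>
     deriv_unit_step_bound * K * indicator {0..1} y"
proof (cases "y \<in> {0..1}")
  case True
  then have "(1 / real (Suc n)) * y \<le> 1" "0 \<le> (1 / real (Suc n)) * y"
    by (auto simp: field_simps simp del: of_nat_Suc)
  then have "\<bar>g (c + (1 / real (Suc n)) * y)\<bar> \<le> K"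
    by (intro assms) auto
  with True show ?thesis
    using abs_deriv_unit_step_le[of y] by (auto simp: abs_mult intro!: mult_mono)
qed (auto simp: deriv_unit_step_eq_0)

text \<open>The substitution x = c + y/(n + 1) moves \<open>n\<close> from the kernel into the
  argument of \<open>g\<close>; the Jacobian cancels the prefactor.\<close>

lemma kernel_integral:
  shows "(LINT x|lborel. real (Suc n) * deriv unit_step (real (Suc n) * (x - c)) * g x) =
      (LINT y|lborel. deriv unit_step y * g (c + (1 / real (Suc n)) * y))"
  by (subst lborel_integral_real_affine[where c = "1 / real (Suc n)" and t = c])
    (auto simp: mult.assoc simp del: of_nat_Suc)

lemma kernel_measurable: "g \<in> borel_measurable borel"
  using g by (rule borel_measurable_continuous_onI)

lemma local_bound: "\<exists>K. \<forall>x\<in>{c..d}. \<bar>g x\<bar> \<le> K"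
proof -
  have "compact (g ` {c..d})"
    by (intro compact_continuous_image continuous_on_subset[OF g]) auto
  then have "bounded (g ` {c..d})"
    by (rule compact_imp_bounded)
  then show ?thesis
    by (simp add: bounded_iff)
qed

lemma kernel_integrable:
  "integrable lborel (\<lambda>x. real (Suc n) * deriv unit_step (real (Suc n) * (x - c)) * g x)"
proof -
  obtain K where K: "\<And>x. x \<in> {c..c + 1} \<Longrightarrow> \<bar>g x\<bar> \<le> K"
    using local_bound by blast
  note [measurable] = kernel_measurable deriv_unit_step_measurable
  have "integrable lborel (\<lambda>y. deriv unit_step y * g (c + (1 / real (Suc n)) * y))"
  proof (rule Bochner_Integration.integrable_bound)
    show "integrable lborel (\<lambda>y. deriv_unit_step_bound * K * indicator {0..1::real} y)"
      by simp
    show "AE y in lborel. norm (deriv unit_step y * g (c + 1 / real (Suc n) * y)) \<le>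
        norm (deriv_unit_step_bound * K * indicator {0..1::real} y)"
      unfolding real_norm_def
      by (intro always_eventually allI order_trans[OF kernel_dominated[OF K] abs_ge_self])
  qed measurable
  from integrable_mult_right[OF lborel_integrable_real_affine[OF this, where c = "real (Suc n)" and t = "- real (Suc n) * c"], of "real (Suc n)"]
  have "integrable lborel (\<lambda>x. real (Suc n) * (deriv unit_step (- real (Suc n) * c + real (Suc n) * x) *
      g (c + 1 / real (Suc n) * (- real (Suc n) * c + real (Suc n) * x))))"
    by (simp del: of_nat_Suc)
  also have "(\<lambda>x. real (Suc n) * (deriv unit_step (- real (Suc n) * c + real (Suc n) * x) *
      g (c + 1 / real (Suc n) * (- real (Suc n) * c + real (Suc n) * x)))) =
    (\<lambda>x. real (Suc n) * deriv unit_step (real (Suc n) * (x - c)) * g x)"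
    by (auto simp: fun_eq_iff right_diff_distrib distrib_left simp del: of_nat_Suc)
  finally show ?thesis .
qed

lemma kernel_bound:
  assumes "\<And>x. x \<in> {c..c + 1} \<Longrightarrow> \<bar>g x\<bar> \<le> K"
  shows "\<bar>LINT x|lborel. real (Suc n) * deriv unit_step (real (Suc n) * (x - c)) * g x\<bar> \<le>
    deriv_unit_step_bound * K"
proof -
  note [measurable] = kernel_measurable deriv_unit_step_measurable
  have "\<bar>LINT y|lborel. deriv unit_step y * g (c + (1 / real (Suc n)) * y)\<bar> \<le>
      (LINT y|lborel. deriv_unit_step_bound * K * indicator {0..1::real} y)"
  proof (rule integral_abs_bound_integral)
    show dom: "integrable lborel (\<lambda>y. deriv_unit_step_bound * K * indicator {0..1::real} y)"
      by simp
    show "integrable lborel (\<lambda>y. deriv unit_step y * g (c + (1 / real (Suc n)) * y))"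
    proof (rule Bochner_Integration.integrable_bound[OF dom])
      show "AE y in lborel. norm (deriv unit_step y * g (c + 1 / real (Suc n) * y)) \<le>
          norm (deriv_unit_step_bound * K * indicator {0..1::real} y)"
        unfolding real_norm_def
        by (intro always_eventually allI order_trans[OF kernel_dominated[OF assms] abs_ge_self])
    qed measurable
  qed (rule kernel_dominated[OF assms])
  then show ?thesis
    by (simp add: kernel_integral del: of_nat_Suc)
qed

lemma kernel_tendsto:
  "(\<lambda>n. LINT x|lborel. real (Suc n) * deriv unit_step (real (Suc n) * (x - c)) * g x) \<longlonglongrightarrow> g c"
proof -
  obtain K where K: "\<And>x. x \<in> {c..c + 1} \<Longrightarrow> \<bar>g x\<bar> \<le> K"
    using local_bound by blast
  note [measurable] = kernel_measurable deriv_unit_step_measurable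
  have "(\<lambda>n. LINT y|lborel. deriv unit_step y * g (c + (1 / real (Suc n)) * y)) \<longlonglongrightarrow>
      (LINT y|lborel. deriv unit_step y * g c)"
  proof (rule integral_dominated_convergence[where w = "\<lambda>y. deriv_unit_step_bound * K * indicator {0..1} y"])
    have "(\<lambda>n. c + 1 / real (Suc n) * y) \<longlonglongrightarrow> c + 0 * y" for y
      by (intro tendsto_intros LIMSEQ_Suc[OF lim_1_over_n])
    then have "(\<lambda>n. g (c + 1 / real (Suc n) * y)) \<longlonglongrightarrow> g c" for y
      using g by (intro isCont_tendsto_compose[of c g]) (auto simp: continuous_on_eq_continuous_at)
    then show "AE y in lborel. (\<lambda>n. deriv unit_step y * g (c + 1 / real (Suc n) * y)) \<longlonglongrightarrow> deriv unit_step y * g c"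
      by (intro always_eventually allI tendsto_intros)
    show "AE y in lborel. norm (deriv unit_step y * g (c + 1 / real (Suc n) * y)) \<le>
        deriv_unit_step_bound * K * indicator {0..1} y" for n
      unfolding real_norm_def by (intro always_eventually allI kernel_dominated[OF K])
  qed simp_all
  moreover have "(LINT y|lborel. deriv unit_step y * g c) = g c"
    using has_bochner_integral_integral_eq[OF deriv_unit_step_has_integral]
    by (subst Bochner_Integration.integral_mult_left_zero) (simp only: mult_1_left)
  ultimately show ?thesis
    unfolding kernel_integral by (simp only:)
qed

lemma integral_deriv_bump:
  "(LINT x|lborel. deriv (bump n a b) x * g x) =
     (LINT x|lborel. real (Suc n) * deriv unit_step (real (Suc n) * (x - a)) * g x) -
     (LINT x|lborel. real (Suc n) * deriv unit_step (real (Suc n) * (x - b)) * g x)"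
  unfolding deriv_bump left_diff_distrib
  by (rule Bochner_Integration.integral_diff[OF kernel_integrable kernel_integrable])

text \<open>The derivative of the bump tends to the Dirac mass at \<open>a\<close> minus the one at
  \<open>b\<close>. This is how testing a weak equation produces boundary values.\<close>

lemma integral_deriv_bump_tendsto:
  "(\<lambda>n. LINT x|lborel. deriv (bump n a b) x * g x) \<longlonglongrightarrow> g a - g b"
  unfolding integral_deriv_bump by (intro tendsto_diff kernel_tendsto)

text \<open>Uniformity in \<open>n\<close> lets the limit of the spatial test functions be taken
  under a time integral.\<close>

lemma integral_deriv_bump_bound:
  assumes "a \<le> b" "\<And>x. x \<in> {a..b + 1} \<Longrightarrow> \<bar>g x\<bar> \<le> K"
  shows "\<bar>LINT x|lborel. deriv (bump n a b) x * g x\<bar> \<le> 2 * deriv_unit_step_bound * K"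
  unfolding integral_deriv_bump
proof (rule order_trans[OF abs_triangle_ineq4])
  show "\<bar>LINT x|lborel. real (Suc n) * deriv unit_step (real (Suc n) * (x - a)) * g x\<bar> +
      \<bar>LINT x|lborel. real (Suc n) * deriv unit_step (real (Suc n) * (x - b)) * g x\<bar> \<le>
      2 * deriv_unit_step_bound * K"
    using kernel_bound[of a K n] kernel_bound[of b K n] assms by (simp del: of_nat_Suc)
qed

end

section \<open>Densities driven by a bounded interaction\<close>

text \<open>The counterpart of \<open>velocity\<close> for a convolution kernel, over
  \<open>lborel\<close>, where product measurability and Tonelli's theorem are at hand.\<close>

definition drift :: "(real \<Rightarrow> real) \<Rightarrow> (real \<Rightarrow> real) \<Rightarrow> real \<Rightarrow> real" where
  "drift \<Psi> \<rho> x = (LINT y|lborel. \<Psi> (x - y) * \<rho> y)"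

text \<open>After the reflection the rough factor \<open>\<Psi>\<close> no longer depends on
  \<open>x\<close>; only the density does, which is continuous in the application.\<close>

lemma drift_reflect: "drift \<Psi> \<rho> x = (LINT z|lborel. \<Psi> z * \<rho> (x - z))"
  unfolding drift_def
  by (subst lborel_integral_real_affine[where c = "-1" and t = x]) auto

lemma AE_lborel_ex:
  assumes "AE x in lborel. x \<in> {a<..<b} \<longrightarrow> P x" "a < (b :: real)"
  shows "\<exists>x\<in>{a<..<b}. P x"
proof (rule ccontr)
  assume "\<not> ?thesis"
  with assms(1) have "AE x in lborel. x \<notin> {a<..<b}"
    by (elim eventually_mono) blast
  then have "emeasure lborel {x \<in> space lborel. x \<in> {a<..<b}} = 0"
    by (rule emeasure_eq_0_AE)
  with assms(2) show False
    by (simp add: greaterThanLessThan_def[symmetric] del: greaterThanLessThan_iff)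
qed

text \<open>The solution after cleaning up null sets: the density is continuous and nonnegative on
  the whole plane, and the kernel is Borel and bounded everywhere.\<close>

locale density_flow =
  fixes C :: real and \<Psi> :: "real \<Rightarrow> real" and u :: "real \<Rightarrow> real \<Rightarrow> real"
  assumes continuous_u: "continuous_on UNIV (\<lambda>(t, x). u t x)"
    and u_nonneg: "0 \<le> u t x"
    and Psi_measurable [measurable]: "\<Psi> \<in> borel_measurable borel"
    and Psi_bounded: "\<bar>\<Psi> z\<bar> \<le> C"
begin

text \<open>Unit mass is given at almost every time only; \<open>good_interior\<close> later extends
  it to every interior time.\<close>

definition good :: "real \<Rightarrow> bool" where
  "good t \<longleftrightarrow> has_bochner_integral lborel (u t) 1"

abbreviation V :: "real \<Rightarrow> real \<Rightarrow> real" where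
  "V t \<equiv> drift \<Psi> (u t)"

lemma C_nonneg: "0 \<le> C"
  using Psi_bounded[of 0] by linarith

lemma continuous_u_compose:
  assumes "continuous_on S g" "continuous_on S h"
  shows "continuous_on S (\<lambda>z. u (g z) (h z))"
  using continuous_on_compose2[OF continuous_u continuous_on_Pair[OF assms]] by simp

lemma u_measurable [measurable (raw)]:
  assumes "g \<in> borel_measurable M" "h \<in> borel_measurable M"
  shows "(\<lambda>z. u (g z) (h z)) \<in> borel_measurable M"
proof -
  have "(\<lambda>(t, x). u t x) \<in> borel_measurable (borel \<Otimes>\<^sub>M borel)"
    unfolding borel_prod by (rule borel_measurable_continuous_onI[OF continuous_u])
  from measurable_compose[OF measurable_Pair[OF assms] this] show ?thesis
    by (simp only: prod.case)
qed

text \<open>This covers all times, including those at which the integral might only have its default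
  value 0.\<close>

lemma V_measurable [measurable (raw)]:
  assumes "g \<in> borel_measurable M" "h \<in> borel_measurable M"
  shows "(\<lambda>z. V (g z) (h z)) \<in> borel_measurable M"
proof -
  have "(\<lambda>p. \<Psi> (h (fst p) - snd p) * u (g (fst p)) (snd p)) \<in> borel_measurable (M \<Otimes>\<^sub>M lborel)"
    by (intro borel_measurable_times measurable_compose[OF _ Psi_measurable] u_measurable
        borel_measurable_diff measurable_compose[OF measurable_fst] assms) simp_all
  then show ?thesis
    unfolding drift_def
    by (intro lborel.borel_measurable_lebesgue_integral) (simp only: case_prod_beta')
qed

lemma good_integrable: "good t \<Longrightarrow> integrable lborel (u t)"
  and good_integral: "good t \<Longrightarrow> (LINT x|lborel. u t x) = 1"
  by (auto simp: good_def has_bochner_integral_iff)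

lemma V_bound: "good t \<Longrightarrow> \<bar>V t x\<bar> \<le> C"
proof -
  assume t: "good t"
  have "\<bar>V t x\<bar> \<le> (LINT y|lborel. C * u t y)"
    unfolding drift_def
  proof (rule integral_abs_bound_integral)
    show dom: "integrable lborel (\<lambda>y. C * u t y)"
      using good_integrable[OF t] by simp
    have le: "\<bar>\<Psi> (x - y) * u t y\<bar> \<le> C * u t y" for y
      using u_nonneg[of t y] Psi_bounded[of "x - y"] by (auto simp: abs_mult intro: mult_right_mono)
    then show "\<bar>\<Psi> (x - y) * u t y\<bar> \<le> C * u t y" for y .
    show "integrable lborel (\<lambda>y. \<Psi> (x - y) * u t y)"
    proof (rule Bochner_Integration.integrable_bound[OF dom])
      show "AE y in lborel. norm (\<Psi> (x - y) * u t y) \<le> norm (C * u t y)"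
        unfolding real_norm_def by (intro always_eventually allI order_trans[OF le abs_ge_self])
      show "(\<lambda>y. \<Psi> (x - y) * u t y) \<in> borel_measurable lborel"
        by (intro borel_measurable_times u_measurable) simp_all
    qed
  qed
  then show ?thesis
    using good_integral[OF t] by simp
qed

text \<open>Scheffe's lemma turns pointwise convergence of probability densities into convergence
  in \<open>L\<^sup>1\<close>, which compensates for \<open>\<Psi>\<close> being merely bounded.\<close>

lemma V_tendsto:
  assumes good: "\<And>n. good (t n)" "good t0" and lim: "t \<longlonglongrightarrow> t0" "x \<longlonglongrightarrow> x0"
  shows "(\<lambda>n. V (t n) (x n)) \<longlonglongrightarrow> V t0 x0"
proof -
  have hbi: "has_bochner_integral lborel (\<lambda>z. u s (y - z)) 1" if "good s" for s y
    using lborel_has_bochner_integral_real_affine_iff[where c = "-1" and t = y and f = "u s" and x = 1] that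
    by (simp add: good_def)
  have int: "integrable lborel (\<lambda>z. u s (y - z))" if "good s" for s y
    using hbi[OF that] by (simp add: has_bochner_integral_iff)
  have Psi_int: "integrable lborel (\<lambda>z. \<Psi> z * u s (y - z))" if "good s" for s y
  proof (rule Bochner_Integration.integrable_bound)
    show "integrable lborel (\<lambda>z. C * u s (y - z))"
      using int[OF that] by simp
    show "AE z in lborel. norm (\<Psi> z * u s (y - z)) \<le> norm (C * u s (y - z))"
      using Psi_bounded C_nonneg u_nonneg by (auto simp: abs_mult intro!: mult_right_mono)
    show "(\<lambda>z. \<Psi> z * u s (y - z)) \<in> borel_measurable lborel"
      by (intro borel_measurable_times u_measurable) simp_all
  qed
  have nn: "(\<integral>\<^sup>+ z. norm (u s (y - z)) \<partial>lborel) = 1" if "good s" for s y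
    using nn_integral_eq_integral[OF int[OF that, of y]] hbi[OF that, of y] u_nonneg
    by (simp add: has_bochner_integral_iff)
  have "(\<lambda>n. \<integral>\<^sup>+ z. norm (u (t n) (x n - z) - u t0 (x0 - z)) \<partial>lborel) \<longlonglongrightarrow> 0"
  proof (rule Scheffe_lemma2)
    have "(\<lambda>n. u (t n) (x n - z)) \<longlonglongrightarrow> u t0 (x0 - z)" for z
    proof -
      have "isCont (\<lambda>(t, x). u t x) (t0, x0 - z)"
        using continuous_u by (simp add: continuous_on_eq_continuous_at)
      moreover have "(\<lambda>n. (t n, x n - z)) \<longlonglongrightarrow> (t0, x0 - z)"
        by (intro tendsto_intros lim)
      ultimately show ?thesis
        using isCont_tendsto_compose[of "(t0, x0 - z)" "\<lambda>(t, x). u t x" "\<lambda>n. (t n, x n - z)"] by simp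
    qed
    then show "AE z in lborel. (\<lambda>n. u (t n) (x n - z)) \<longlonglongrightarrow> u t0 (x0 - z)" by simp
  qed (use good int nn in \<open>auto intro: borel_measurable_integrable\<close>)
  moreover have "(\<integral>\<^sup>+ z. norm (u (t n) (x n - z) - u t0 (x0 - z)) \<partial>lborel) =
      ennreal (LINT z|lborel. norm (u (t n) (x n - z) - u t0 (x0 - z)))" for n
    by (rule nn_integral_eq_integral) (use int good in auto)
  ultimately have "(\<lambda>n. ennreal (LINT z|lborel. norm (u (t n) (x n - z) - u t0 (x0 - z)))) \<longlonglongrightarrow> ennreal 0"
    by simp
  then have L1: "(\<lambda>n. LINT z|lborel. norm (u (t n) (x n - z) - u t0 (x0 - z))) \<longlonglongrightarrow> 0"
    by (rule tendsto_ennrealD) auto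
  \<comment> \<open>In the reflected form both terms carry the same factor \<open>\<Psi> z\<close>,
    so the sup bound \<open>C\<close> can be pulled out and the \<open>L\<^sup>1\<close> distance of
    the shifted densities remains.\<close>
  have bound: "\<bar>V (t n) (x n) - V t0 x0\<bar> \<le> C * (LINT z|lborel. norm (u (t n) (x n - z) - u t0 (x0 - z)))" for n
  proof -
    have "V (t n) (x n) - V t0 x0 = (LINT z|lborel. \<Psi> z * u (t n) (x n - z) - \<Psi> z * u t0 (x0 - z))"
      unfolding drift_reflect
      by (rule Bochner_Integration.integral_diff[symmetric]) (use Psi_int good in auto)
    also have "\<bar>\<dots>\<bar> \<le> (LINT z|lborel. C * norm (u (t n) (x n - z) - u t0 (x0 - z)))"
    proof (rule integral_abs_bound_integral)
      show "\<bar>\<Psi> z * u (t n) (x n - z) - \<Psi> z * u t0 (x0 - z)\<bar> \<le> C * norm (u (t n) (x n - z) - u t0 (x0 - z))" for z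
        using Psi_bounded[of z] by (auto simp: abs_mult right_diff_distrib[symmetric] intro!: mult_right_mono)
    qed (use Psi_int int good in auto)
    finally show ?thesis by simp
  qed
  have "(\<lambda>n. V (t n) (x n) - V t0 x0) \<longlonglongrightarrow> 0"
  proof (rule Lim_null_comparison)
    show "\<forall>\<^sub>F n in sequentially. norm (V (t n) (x n) - V t0 x0) \<le>
        C * (LINT z|lborel. norm (u (t n) (x n - z) - u t0 (x0 - z)))"
      using bound by simp
    show "(\<lambda>n. C * (LINT z|lborel. norm (u (t n) (x n - z) - u t0 (x0 - z)))) \<longlonglongrightarrow> 0"
      using tendsto_mult_left[OF L1, of C] by simp
  qed
  then show ?thesis
    by (rule LIM_zero_cancel)
qed

lemma continuous_uV: "good t \<Longrightarrow> continuous_on UNIV (\<lambda>x. u t x * V t x)"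
  by (intro continuous_on_mult continuous_u_compose continuous_intros)
    (auto simp: continuous_on_sequentially o_def intro: V_tendsto)

lemma u_local_bound: "\<exists>K. \<forall>t\<in>{s..s'}. \<forall>x\<in>{a..b}. u t x \<le> K"
proof -
  have "compact ((\<lambda>(t, x). u t x) ` ({s..s'} \<times> {a..b}))"
    by (intro compact_continuous_image continuous_on_subset[OF continuous_u] compact_Times) auto
  then have "bounded ((\<lambda>(t, x). u t x) ` ({s..s'} \<times> {a..b}))"
    by (rule compact_imp_bounded)
  then obtain K where K: "\<And>y. y \<in> (\<lambda>(t, x). u t x) ` ({s..s'} \<times> {a..b}) \<Longrightarrow> norm y \<le> K"
    unfolding bounded_iff by blast
  have "u t x \<le> K" if "t \<in> {s..s'}" "x \<in> {a..b}" for t x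
    using K[of "u t x"] that by (force simp del: atLeastAtMost_iff)
  then show ?thesis by blast
qed

end

section \<open>The balance law on intervals\<close>

lemma deriv_bump_measurable: "deriv (bump m a b) \<in> borel_measurable borel"
  by (intro borel_measurable_smooth smooth_deriv smooth_bump)

lemma set_integrable_bounded_AE:
  fixes g :: "real \<Rightarrow> real"
  assumes "g \<in> borel_measurable borel" "AE r in lborel. r \<in> {s..t} \<longrightarrow> \<bar>g r\<bar> \<le> K"
  shows "set_integrable lborel {s..t} g"
  unfolding set_integrable_def
proof (rule Bochner_Integration.integrable_bound)
  show "integrable lborel (\<lambda>r. K * indicator {s..t} r)"
    by (intro integrable_mult_right integrable_real_indicator) (auto simp: emeasure_lborel_Icc_eq)
  show "AE r in lborel. norm (indicator {s..t} r *\<^sub>R g r) \<le> norm (K * indicator {s..t} r)"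
    using assms(2) by eventually_elim (auto simp: indicator_def)
qed (use assms(1) in measurable)

text \<open>The transport equation tested with products \<eta>(t) \<zeta>(x). The time derivative of
  the solution has been eliminated, so only the density and its flux appear.\<close>

locale mass_transport = density_flow +
  fixes T :: real
  assumes good_AE: "AE t in lborel. t \<in> {0<..<T} \<longrightarrow> good t"
    and weak: "\<zeta> \<in> test_functions UNIV \<Longrightarrow> \<eta> \<in> test_functions {0<..<T} \<Longrightarrow>
      (LINT t|lborel. deriv \<eta> t * (LINT x|lborel. u t x * \<zeta> x)) =
      - (LINT t|lborel. \<eta> t * (LINT x|lborel. u t x * V t x * deriv \<zeta> x))"
begin

text \<open>A smoothed net inflow into \<open>{a..b}\<close>: at good times it tends to the flux at
  \<open>a\<close> minus the flux at \<open>b\<close> as \<open>m\<close> grows.\<close>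

definition weak_flux :: "nat \<Rightarrow> real \<Rightarrow> real \<Rightarrow> real \<Rightarrow> real" where
  "weak_flux m a b r = (LINT x|lborel. u r x * V r x * deriv (bump m a b) x)"

lemma weak_flux_eq: "weak_flux m a b r = (LINT x|lborel. deriv (bump m a b) x * (u r x * V r x))"
  by (simp add: weak_flux_def mult.commute)

lemma weak_flux_measurable: "weak_flux m a b \<in> borel_measurable borel"
proof -
  note [measurable] = deriv_bump_measurable
  show ?thesis
    unfolding weak_flux_def[abs_def] by measurable
qed

text \<open>The density is bounded on the compact set \<open>{0..T} \<times> {a..b + 1}\<close>, the
  drift by \<open>C\<close>, and the kernel estimate does not see \<open>m\<close>. So
  \<open>K\<close> is uniform in both \<open>m\<close> and \<open>r\<close>.\<close>

lemma weak_flux_bound: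
  assumes "a \<le> b"
  obtains K where "\<And>m r. r \<in> {0<..<T} \<Longrightarrow> good r \<Longrightarrow> \<bar>weak_flux m a b r\<bar> \<le> K"
proof -
  obtain K where K: "\<forall>t\<in>{0..T}. \<forall>x\<in>{a..b + 1}. u t x \<le> K"
    using u_local_bound by blast
  have "\<bar>weak_flux m a b r\<bar> \<le> 2 * deriv_unit_step_bound * (K * C)" if r: "r \<in> {0<..<T}" "good r" for m r
    unfolding weak_flux_eq
  proof (rule integral_deriv_bump_bound[OF continuous_uV[OF r(2)] assms])
    fix x assume x: "x \<in> {a..b + 1}"
    have "u r x \<le> K"
      using K r x by auto
    then show "\<bar>u r x * V r x\<bar> \<le> K * C"
      using u_nonneg[of r x] V_bound[OF r(2), of x] by (auto simp: abs_mult intro!: mult_mono)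
  qed
  then show ?thesis by (rule that)
qed

text \<open>The compact support of the bump reduces this to a jointly continuous integrand on a
  fixed compact interval, so the result covers all times, good or not.\<close>

lemma continuous_on_integral_bump:
  assumes "a \<le> b"
  shows "continuous_on UNIV (\<lambda>t. LINT x|lborel. u t x * bump m a b x)"
proof -
  have "(LINT x|lborel. u t x * bump m a b x) = integral (cbox a (b + 1)) (\<lambda>x. u t x * bump m a b x)" for t
  proof -
    have "(LINT x|lborel. u t x * bump m a b x) = (LINT x:{a..b + 1}|lborel. u t x * bump m a b x)"
      unfolding set_lebesgue_integral_def
      by (rule Bochner_Integration.integral_cong) (use bump_eq_0_outside[OF assms] in \<open>auto simp: indicator_def\<close>)
    also have "\<dots> = integral {a..b + 1} (\<lambda>x. u t x * bump m a b x)"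
      by (intro set_borel_integral_eq_integral(2) borel_integrable_atLeastAtMost' continuous_intros
          continuous_u_compose continuous_on_smooth smooth_bump)
    finally show ?thesis by simp
  qed
  moreover have "continuous_on UNIV (\<lambda>t. integral (cbox a (b + 1)) (\<lambda>x. u t x * bump m a b x))"
  proof (rule integral_continuous_on_param)
    have "continuous_on (UNIV \<times> cbox a (b + 1)) (\<lambda>z. u (fst z) (snd z) * bump m a b (snd z))"
      by (intro continuous_intros continuous_u_compose
          continuous_on_compose2[OF continuous_on_smooth[OF smooth_bump, of UNIV]]) auto
    then show "continuous_on (UNIV \<times> cbox a (b + 1)) (\<lambda>(t, x). u t x * bump m a b x)"
      by (simp only: case_prod_beta')
  qed
  ultimately show ?thesis by simp
qed

text \<open>The time test function is a bump for \<open>{s..t}\<close>: its derivative picks out the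
  values at \<open>s\<close> and \<open>t\<close>, while the bump itself tends to the
  indicator.\<close>

lemma transport_bump:
  assumes "a \<le> b" "0 < s" "s \<le> t" "t < T"
  shows "(LINT x|lborel. u t x * bump m a b x) - (LINT x|lborel. u s x * bump m a b x) =
    (LINT r:{s..t}|lborel. weak_flux m a b r)"
proof -
  define M where "M t = (LINT x|lborel. u t x * bump m a b x)" for t
  \<comment> \<open>\<open>integral_bump_tendsto\<close> asks for integrability up to
    \<open>t + 1\<close>, which may exceed \<open>T\<close>; the cutoff removes the times without a
    bound.\<close>
  define g where "g r = indicator {0<..<T} r * weak_flux m a b r" for r
  have gm: "g \<in> borel_measurable borel"
    unfolding g_def[abs_def] using weak_flux_measurable by measurable
  obtain K where K: "\<And>m r. r \<in> {0<..<T} \<Longrightarrow> good r \<Longrightarrow> \<bar>weak_flux m a b r\<bar> \<le> K"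
    using weak_flux_bound[OF assms(1)] by blast
  have "AE r in lborel. r \<in> {s..t+1} \<longrightarrow> \<bar>g r\<bar> \<le> max K 0"
    using good_AE
  proof eventually_elim
    case (elim r)
    then show ?case
      using K[of r m] by (cases "r \<in> {0<..<T}") (auto simp: g_def indicator_def le_max_iff_disj)
  qed
  then have "set_integrable lborel {s..t + 1} g"
    by (rule set_integrable_bounded_AE[OF gm])
  from integral_bump_tendsto[OF \<open>s \<le> t\<close> this] gm
  have "(\<lambda>n. LINT r|lborel. bump n s t r * g r) \<longlonglongrightarrow> (LINT r:{s..t}|lborel. g r)"
    by simp
  moreover have "(LINT r:{s..t}|lborel. g r) = (LINT r:{s..t}|lborel. weak_flux m a b r)"
    using assms by (intro set_lebesgue_integral_cong) (auto simp: g_def)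
  ultimately have 1: "(\<lambda>n. - (LINT r|lborel. bump n s t r * g r)) \<longlonglongrightarrow> - (LINT r:{s..t}|lborel. weak_flux m a b r)"
    by (auto intro: tendsto_minus)
  have 2: "(\<lambda>n. LINT r|lborel. deriv (bump n s t) r * M r) \<longlonglongrightarrow> M s - M t"
    unfolding M_def by (rule integral_deriv_bump_tendsto[OF continuous_on_integral_bump[OF assms(1)]])
  \<comment> \<open>Since \<open>t < T\<close>, the right layer of the time bump eventually lies
    inside \<open>{0<..<T}\<close> and the bump is admissible.\<close>
  have "(\<lambda>n. t + 1 / real (Suc n)) \<longlonglongrightarrow> t + 0"
    by (intro tendsto_intros LIMSEQ_Suc[OF lim_1_over_n])
  then have "\<forall>\<^sub>F n in sequentially. t + 1 / real (Suc n) < T"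
    using assms(4) by (intro order_tendstoD) auto
  then have "\<forall>\<^sub>F n in sequentially. (LINT r|lborel. deriv (bump n s t) r * M r) = - (LINT r|lborel. bump n s t r * g r)"
  proof eventually_elim
    case (elim n)
    have sub: "{s..t + 1 / real (Suc n)} \<subseteq> {0<..<T}"
      using elim assms by auto
    have "(LINT r|lborel. deriv (bump n s t) r * M r) = - (LINT r|lborel. bump n s t r * weak_flux m a b r)"
      unfolding M_def weak_flux_def
      by (rule weak[OF bump_in_test_functions[OF assms(1)] bump_in_test_functions[OF assms(3) sub]]) simp
    also have "(\<lambda>r. bump n s t r * weak_flux m a b r) = (\<lambda>r. bump n s t r * g r)"
      using bump_eq_0[OF assms(3), of _ n] sub by (fastforce simp: g_def indicator_def fun_eq_iff)
    finally show ?case .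
  qed
  from Lim_transform_eventually[OF 2 this] have "M s - M t = - (LINT r:{s..t}|lborel. weak_flux m a b r)"
    using LIMSEQ_unique[OF _ 1] by blast
  then show ?thesis
    by (simp add: M_def)
qed

text \<open>The net mass crossing \<open>x\<close> from left to right between the times
  \<open>s\<close> and \<open>t\<close>.\<close>

definition flux :: "real \<Rightarrow> real \<Rightarrow> real \<Rightarrow> real" where
  "flux s t x = (LINT r:{s..t}|lborel. u r x * V r x)"

lemma flux_integrable:
  assumes "0 < s" "t < T"
  shows "set_integrable lborel {s..t} (\<lambda>r. u r x * V r x)"
proof -
  obtain K where K: "\<forall>t\<in>{0..T}. \<forall>x\<in>{x..x}. u t x \<le> K"
    using u_local_bound by blast
  show ?thesis
  proof (rule set_integrable_bounded_AE)
    show "AE r in lborel. r \<in> {s..t} \<longrightarrow> \<bar>u r x * V r x\<bar> \<le> K * C"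
      using good_AE
    proof eventually_elim
      case (elim r)
      show ?case
      proof
        assume r: "r \<in> {s..t}"
        with assms elim have "good r" "u r x \<le> K"
          using K by auto
        then show "\<bar>u r x * V r x\<bar> \<le> K * C"
          using u_nonneg[of r x] V_bound[of r x] by (auto simp: abs_mult intro!: mult_mono)
      qed
    qed
  qed measurable
qed

lemma u_set_integrable: "set_integrable lborel {a..b} (u t)"
  by (intro borel_integrable_atLeastAtMost' continuous_u_compose continuous_intros)

text \<open>The limit of \<open>transport_bump\<close> as \<open>m\<close> grows; on the flux side,
  \<open>weak_flux_bound\<close> provides the majorant in time.\<close>

lemma transport_interval:
  assumes "a \<le> b" "0 < s" "s \<le> t" "t < T"
  shows "(LINT x:{a..b}|lborel. u t x) - (LINT x:{a..b}|lborel. u s x) = flux s t a - flux s t b"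
proof -
  have "(\<lambda>m. LINT x|lborel. u t x * bump m a b x) \<longlonglongrightarrow> (LINT x:{a..b}|lborel. u t x)" for t
    using integral_bump_tendsto[OF assms(1) u_set_integrable, of t] by (simp add: mult.commute)
  then have "(\<lambda>m. LINT r:{s..t}|lborel. weak_flux m a b r) \<longlonglongrightarrow>
      (LINT x:{a..b}|lborel. u t x) - (LINT x:{a..b}|lborel. u s x)"
    unfolding transport_bump[OF assms, symmetric] by (intro tendsto_diff)
  moreover have "(\<lambda>m. LINT r:{s..t}|lborel. weak_flux m a b r) \<longlonglongrightarrow>
      (LINT r:{s..t}|lborel. u r a * V r a - u r b * V r b)"
    unfolding set_lebesgue_integral_def
  proof -
    obtain K where K: "\<And>m r. r \<in> {0<..<T} \<Longrightarrow> good r \<Longrightarrow> \<bar>weak_flux m a b r\<bar> \<le> K"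
      using weak_flux_bound[OF assms(1)] by blast
    show "(\<lambda>m. LINT r|lborel. indicator {s..t} r *\<^sub>R weak_flux m a b r) \<longlonglongrightarrow>
      (LINT r|lborel. indicator {s..t} r *\<^sub>R (u r a * V r a - u r b * V r b))"
    proof (rule integral_dominated_convergence)
      show "integrable lborel (\<lambda>r. K * indicator {s..t} r)"
    by (intro integrable_mult_right integrable_real_indicator) (auto simp: emeasure_lborel_Icc_eq)
      show "AE r in lborel. norm (indicator {s..t} r *\<^sub>R weak_flux m a b r) \<le> K * indicator {s..t} r" for m
        using good_AE by eventually_elim (use K assms in \<open>auto simp: indicator_def\<close>)
      show "AE r in lborel. (\<lambda>m. indicator {s..t} r *\<^sub>R weak_flux m a b r) \<longlonglongrightarrow>
          indicator {s..t} r *\<^sub>R (u r a * V r a - u r b * V r b)"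
        using good_AE
      proof eventually_elim
        case (elim r)
        show ?case
        proof (cases "r \<in> {s..t}")
          case True
          with elim assms have "good r" by auto
          from integral_deriv_bump_tendsto[OF continuous_uV[OF this], of a b]
          show ?thesis
            unfolding weak_flux_eq by (intro tendsto_intros)
        qed simp
      qed
    qed (use weak_flux_measurable in measurable)
  qed
  ultimately have "(LINT x:{a..b}|lborel. u t x) - (LINT x:{a..b}|lborel. u s x) =
      (LINT r:{s..t}|lborel. u r a * V r a - u r b * V r b)"
    by (rule LIMSEQ_unique)
  also have "\<dots> = flux s t a - flux s t b"
    unfolding flux_def using assms
    by (intro set_integral_diff flux_integrable)
  finally show ?thesis .
qed

end

section \<open>Conservation of mass and the distribution function\<close>

lemma indicator_Icc_tendsto_1:
  fixes A B :: "nat \<Rightarrow> real"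
  assumes "filterlim A at_bot sequentially" "filterlim B at_top sequentially"
  shows "(\<lambda>n. indicator {A n..B n} x :: real) \<longlonglongrightarrow> 1"
proof (rule tendsto_eventually)
  have "\<forall>\<^sub>F n in sequentially. A n \<le> x" "\<forall>\<^sub>F n in sequentially. x \<le> B n"
    using assms by (auto simp: filterlim_at_bot filterlim_at_top)
  then show "\<forall>\<^sub>F n in sequentially. (indicator {A n..B n} x :: real) = 1"
    by eventually_elim simp
qed

lemma set_integral_Icc_tendsto:
  fixes h :: "real \<Rightarrow> real"
  assumes h: "integrable lborel h"
    and "filterlim A at_bot sequentially" "filterlim B at_top sequentially"
  shows "(\<lambda>n. LINT x:{A n..B n}|lborel. h x) \<longlonglongrightarrow> (LINT x|lborel. h x)"
  unfolding set_lebesgue_integral_def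
proof (rule integral_dominated_convergence)
  show "integrable lborel (\<lambda>x. \<bar>h x\<bar>)" using h by simp
  show "AE x in lborel. (\<lambda>n. indicator {A n..B n} x *\<^sub>R h x) \<longlonglongrightarrow> h x"
  proof (intro always_eventually allI)
    fix x
    show "(\<lambda>n. indicator {A n..B n} x *\<^sub>R h x) \<longlonglongrightarrow> h x"
      using tendsto_scaleR[OF indicator_Icc_tendsto_1[OF assms(2,3), of x] tendsto_const[of "h x"]] by simp
  qed
qed (use h in \<open>auto simp: indicator_def\<close>)

text \<open>The intervals may fail to be nested, so Fatou's lemma takes the place of monotone
  convergence and yields integrability. The value then follows from
  \<open>set_integral_Icc_tendsto\<close>.\<close>

lemma has_bochner_integral_Icc_limit:
  fixes h :: "real \<Rightarrow> real"
  assumes h: "\<And>x. 0 \<le> h x" "\<And>a b. set_integrable lborel {a..b} h"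
    and [measurable]: "h \<in> borel_measurable borel"
    and A: "filterlim A at_bot sequentially" and B: "filterlim B at_top sequentially"
    and lim: "(\<lambda>n. LINT x:{A n..B n}|lborel. h x) \<longlonglongrightarrow> m"
  shows "has_bochner_integral lborel h m"
proof -
  have "(\<integral>\<^sup>+ x. ennreal (h x) \<partial>lborel) = (\<integral>\<^sup>+ x. liminf (\<lambda>n. ennreal (indicator {A n..B n} x * h x)) \<partial>lborel)"
  proof (rule nn_integral_cong)
    fix x
    have "(\<lambda>n. ennreal (indicator {A n..B n} x * h x)) \<longlonglongrightarrow> ennreal (h x)"
      using tendsto_mult[OF indicator_Icc_tendsto_1[OF A B, of x] tendsto_const[of "h x"]]
      by (intro tendsto_ennrealI) simp
    then show "ennreal (h x) = liminf (\<lambda>n. ennreal (indicator {A n..B n} x * h x))"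
      by (simp add: lim_imp_Liminf)
  qed
  also have "\<dots> \<le> liminf (\<lambda>n. \<integral>\<^sup>+ x. ennreal (indicator {A n..B n} x * h x) \<partial>lborel)"
    by (rule nn_integral_liminf) measurable
  also have "(\<lambda>n. \<integral>\<^sup>+ x. ennreal (indicator {A n..B n} x * h x) \<partial>lborel) =
      (\<lambda>n. ennreal (LINT x:{A n..B n}|lborel. h x))"
  proof
    fix n
    have "integrable lborel (\<lambda>x. indicator {A n..B n} x * h x)"
      using h(2)[of "A n" "B n"] by (simp add: set_integrable_def)
    then show "(\<integral>\<^sup>+ x. ennreal (indicator {A n..B n} x * h x) \<partial>lborel) =
        ennreal (LINT x:{A n..B n}|lborel. h x)"
      using h(1) by (subst nn_integral_eq_integral) (auto simp: set_lebesgue_integral_def)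
  qed
  also have "liminf (\<lambda>n. ennreal (LINT x:{A n..B n}|lborel. h x)) = ennreal m"
    using tendsto_ennrealI[OF lim] by (simp add: lim_imp_Liminf)
  finally have "integrable lborel h"
    using h(1) by (intro integrableI_bounded) (auto simp: less_le_trans order_le_less_trans)
  moreover from set_integral_Icc_tendsto[OF this A B] lim have "(LINT x|lborel. h x) = m"
    using LIMSEQ_unique by blast
  ultimately show ?thesis
    by (simp add: has_bochner_integral_iff)
qed

text \<open>Meant for half-lines, which contain intervals of every length; their infinite measure is
  what \<open>flux_small\<close> exploits.\<close>

lemma emeasure_lborel_eq_infinity:
  assumes "S \<in> sets borel" "\<And>n :: nat. \<exists>a. {a..a + real n} \<subseteq> S"
  shows "emeasure lborel S = \<infinity>"
proof (cases "emeasure lborel S")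
  case (real r)
  obtain n :: nat where "r < real n"
    using reals_Archimedean2 by blast
  moreover obtain a where "{a..a + real n} \<subseteq> S"
    using assms(2) by blast
  then have "emeasure lborel {a..a + real n} \<le> emeasure lborel S"
    using assms(1) by (intro emeasure_mono) auto
  ultimately show ?thesis
    using real by (simp add: ennreal_le_iff)
qed simp

lemma emeasure_lborel_atMost: "emeasure lborel {..b :: real} = \<infinity>"
  by (rule emeasure_lborel_eq_infinity) (auto intro!: exI[of _ "b - real _"])

lemma emeasure_lborel_atLeast: "emeasure lborel {b :: real..} = \<infinity>"
  by (rule emeasure_lborel_eq_infinity) (auto intro!: exI[of _ b])

context mass_transport
begin

text \<open>By Tonelli's theorem the flux is an integrable function of \<open>x\<close>.\<close>

lemma flux_small:
  assumes st: "0 < s" "s \<le> t" "t < T" and S: "S \<in> sets borel" "emeasure lborel S = \<infinity>" and e: "0 < \<epsilon>"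
  shows "\<exists>x\<in>S. \<bar>flux s t x\<bar> \<le> \<epsilon>"
proof (rule ccontr)
  assume "\<not> ?thesis"
  then have large: "\<And>x. x \<in> S \<Longrightarrow> \<epsilon> \<le> \<bar>flux s t x\<bar>" by force
  \<comment> \<open>A nonnegative majorant of the flux density, taken in \<open>ennreal\<close> so
    that the order of integration can be exchanged without prior integrability.\<close>
  define k where "k x r = indicator {s..t} r * ennreal (C * u r x)" for x r
  have flux_le: "ennreal \<bar>flux s t x\<bar> \<le> (\<integral>\<^sup>+ r. k x r \<partial>lborel)" for x
  proof -
    have "ennreal (norm (flux s t x)) \<le> (\<integral>\<^sup>+ r. norm (indicator {s..t} r *\<^sub>R (u r x * V r x)) \<partial>lborel)"
      unfolding flux_def set_lebesgue_integral_def
      by (rule integral_norm_bound_ennreal) (use flux_integrable[OF st(1,3)] in \<open>simp only: set_integrable_def\<close>)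
    also have "\<dots> \<le> (\<integral>\<^sup>+ r. k x r \<partial>lborel)"
    proof (rule nn_integral_mono_AE)
      show "AE r in lborel. ennreal (norm (indicator {s..t} r *\<^sub>R (u r x * V r x))) \<le> k x r"
        using good_AE
      proof eventually_elim
        case (elim r)
        show ?case
        proof (cases "r \<in> {s..t}")
          case True
          with elim st have "good r" by auto
          then have "\<bar>u r x * V r x\<bar> \<le> C * u r x"
            using V_bound[of r x] u_nonneg[of r x]
            by (auto simp: abs_mult mult.commute[of C] intro!: mult_left_mono)
          with True show ?thesis
            by (simp add: k_def ennreal_leI)
        qed simp
      qed
    qed
    finally show ?thesis by simp
  qed
  have [measurable]: "(\<lambda>(x, r). k x r) \<in> borel_measurable (lborel \<Otimes>\<^sub>M lborel)"
    unfolding k_def by measurable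
  \<comment> \<open>A flux of size at least \<open>\<epsilon>\<close> throughout \<open>S\<close>
    would make the left side infinite, whereas unit mass at almost every time bounds the double
    integral by \<open>C (t - s)\<close>.\<close>
  have "(\<integral>\<^sup>+ x. ennreal \<epsilon> * indicator S x \<partial>lborel) \<le> (\<integral>\<^sup>+ x. \<integral>\<^sup>+ r. k x r \<partial>lborel \<partial>lborel)"
  proof (rule nn_integral_mono)
    fix x
    show "ennreal \<epsilon> * indicator S x \<le> (\<integral>\<^sup>+ r. k x r \<partial>lborel)"
      using order_trans[OF ennreal_leI[OF large] flux_le[of x]] by (cases "x \<in> S") auto
  qed
  also have "\<dots> = (\<integral>\<^sup>+ r. \<integral>\<^sup>+ x. k x r \<partial>lborel \<partial>lborel)"
    by (rule lborel_pair.Fubini'[symmetric]) measurable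
  also have "\<dots> \<le> (\<integral>\<^sup>+ r. ennreal C * indicator {s..t} r \<partial>lborel)"
  proof (rule nn_integral_mono_AE)
    show "AE r in lborel. (\<integral>\<^sup>+ x. k x r \<partial>lborel) \<le> ennreal C * indicator {s..t} r"
      using good_AE
    proof eventually_elim
      case (elim r)
      show ?case
      proof (cases "r \<in> {s..t}")
        case True
        with elim st have "good r" by auto
        then have "(\<integral>\<^sup>+ x. ennreal (C * u r x) \<partial>lborel) = ennreal (LINT x|lborel. C * u r x)"
          using C_nonneg u_nonneg good_integrable by (intro nn_integral_eq_integral) auto
        with True \<open>good r\<close> show ?thesis
          by (simp add: k_def good_integral)
      qed (simp add: k_def)
    qed
  qed
  also have "\<dots> < \<infinity>"
    by (simp add: nn_integral_cmult emeasure_lborel_Icc_eq ennreal_mult_less_top)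
  finally have "ennreal \<epsilon> * emeasure lborel S < \<infinity>"
    using S(1) by (simp add: nn_integral_cmult)
  with S(2) e show False
    by (simp add: ennreal_mult_top)
qed

text \<open>Integrability in \<open>x\<close> gives no limit at infinity, but each set of infinite
  measure contains points of arbitrarily small flux; one is chosen in each
  \<open>S n\<close>.\<close>

lemma flux_vanishing:
  assumes st: "0 < s" "s \<le> t" "t < T" and S: "\<And>n. S n \<in> sets borel" "\<And>n. emeasure lborel (S n) = \<infinity>"
  obtains A :: "nat \<Rightarrow> real" where "\<And>n. A n \<in> S n" "(\<lambda>n. flux s t (A n)) \<longlonglongrightarrow> 0"
proof -
  have "\<exists>A. \<forall>n. A n \<in> S n \<and> \<bar>flux s t (A n)\<bar> \<le> 1 / real (Suc n)"
    using flux_small[OF st S] by (intro choice) (meson divide_pos_pos of_nat_0_less_iff zero_less_Suc zero_less_one)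
  then obtain A where A: "\<And>n. A n \<in> S n" "\<And>n. \<bar>flux s t (A n)\<bar> \<le> 1 / real (Suc n)" by blast
  have "(\<lambda>n. flux s t (A n)) \<longlonglongrightarrow> 0"
    by (rule Lim_null_comparison[OF _ LIMSEQ_Suc[OF lim_1_over_n]]) (use A(2) in auto)
  with A(1) show ?thesis by (rule that)
qed

lemma flux_vanishing_at_bot:
  assumes st: "0 < s" "s \<le> t" "t < T"
  obtains A :: "nat \<Rightarrow> real" where "filterlim A at_bot sequentially" "\<And>n. A n \<le> b" "(\<lambda>n. flux s t (A n)) \<longlonglongrightarrow> 0"
proof -
  obtain A where A: "\<And>n. A n \<in> {..b - real n}" "(\<lambda>n. flux s t (A n)) \<longlonglongrightarrow> 0"
    using flux_vanishing[OF st _ emeasure_lborel_atMost, of "\<lambda>n. b - real n"] by auto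
  have "filterlim (\<lambda>n. b - real n) at_bot sequentially"
    by real_asymp
  then have "filterlim A at_bot sequentially"
    by (rule filterlim_at_bot_mono) (use A(1) in auto)
  moreover have "A n \<le> b" for n
    using A(1)[of n] by simp
  ultimately show ?thesis
    using A(2) by (intro that)
qed

lemma flux_vanishing_at_top:
  assumes st: "0 < s" "s \<le> t" "t < T"
  obtains A :: "nat \<Rightarrow> real" where "filterlim A at_top sequentially" "\<And>n. b \<le> A n" "(\<lambda>n. flux s t (A n)) \<longlonglongrightarrow> 0"
proof -
  obtain A where A: "\<And>n. A n \<in> {b + real n..}" "(\<lambda>n. flux s t (A n)) \<longlonglongrightarrow> 0"
    using flux_vanishing[OF st _ emeasure_lborel_atLeast, of "\<lambda>n. b + real n"] by auto
  have "filterlim (\<lambda>n. b + real n) at_top sequentially"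
    by real_asymp
  then have "filterlim A at_top sequentially"
    by (rule filterlim_at_top_mono) (use A(1) in auto)
  moreover have "b \<le> A n" for n
    using A(1)[of n] by simp
  ultimately show ?thesis
    using A(2) by (intro that)
qed

text \<open>Good times have full measure, so one exists before \<open>t\<close>. From there the mass
  of \<open>{A n..B n}\<close> changes only by the fluxes at its ends, which tend to 0 for suitable
  endpoints.\<close>

lemma good_interior:
  assumes "t \<in> {0<..<T}"
  shows "good t"
proof -
  obtain s where s: "s \<in> {0<..<t}" "good s"
  proof -
    have "AE r in lborel. r \<in> {0<..<t} \<longrightarrow> good r"
      using good_AE by eventually_elim (use assms in auto)
    from AE_lborel_ex[OF this] assms that show ?thesis by auto
  qed
  then have st: "0 < s" "s \<le> t" "t < T" using assms by auto
  obtain A where A: "filterlim A at_bot sequentially" "\<And>n. A n \<le> 0" "(\<lambda>n. flux s t (A n)) \<longlonglongrightarrow> 0"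
    using flux_vanishing_at_bot[OF st] by blast
  obtain B where B: "filterlim B at_top sequentially" "\<And>n. 0 \<le> B n" "(\<lambda>n. flux s t (B n)) \<longlonglongrightarrow> 0"
    using flux_vanishing_at_top[OF st] by blast
  have "(LINT x:{A n..B n}|lborel. u s x) + (flux s t (A n) - flux s t (B n)) =
      (LINT x:{A n..B n}|lborel. u t x)" for n
    using transport_interval[OF order_trans[OF A(2) B(2)] st, of n n] by linarith
  moreover have "(\<lambda>n. (LINT x:{A n..B n}|lborel. u s x) + (flux s t (A n) - flux s t (B n))) \<longlonglongrightarrow> 1 + (0 - 0)"
    using set_integral_Icc_tendsto[OF good_integrable[OF s(2)] A(1) B(1)] good_integral[OF s(2)]
    by (intro tendsto_intros A(3) B(3)) simp
  ultimately have "(\<lambda>n. LINT x:{A n..B n}|lborel. u t x) \<longlonglongrightarrow> 1"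
    by simp
  then show ?thesis
    unfolding good_def
    by (intro has_bochner_integral_Icc_limit[OF u_nonneg u_set_integrable _ A(1) B(1)]) measurable
qed

definition distribution_function :: "real \<Rightarrow> real \<Rightarrow> real" where
  "distribution_function t b = (LINT x:{..b}|lborel. u t x)"

text \<open>The balance law on \<open>{A n..b}\<close>, with the left end sent to minus infinity
  along points where the flux vanishes.\<close>

lemma distribution_function_diff:
  assumes st: "0 < s" "s \<le> t" "t < T"
  shows "distribution_function t b - distribution_function s b = - flux s t b"
proof -
  obtain A where A: "filterlim A at_bot sequentially" "\<And>n. A n \<le> b" "(\<lambda>n. flux s t (A n)) \<longlonglongrightarrow> 0"
    using flux_vanishing_at_bot[OF st] by blast
  have lim: "(\<lambda>n. LINT x:{A n..b}|lborel. u r x) \<longlonglongrightarrow> distribution_function r b" if "r \<in> {s, t}" for r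
  proof -
    have "good r" using that st by (intro good_interior) auto
    then have int: "integrable lborel (\<lambda>x. indicator {..b} x * u r x)"
      using integrable_mult_indicator[of "{..b}" lborel "u r"] good_integrable by simp
    \<comment> \<open>The moving right end only serves to fit
      \<open>set_integral_Icc_tendsto\<close>; the indicator of \<open>{..b}\<close> cuts the
      integral off at \<open>b\<close>.\<close>
    have "filterlim (\<lambda>n. b + real n) at_top sequentially"
      by real_asymp
    from set_integral_Icc_tendsto[OF int A(1) this]
    have "(\<lambda>n. LINT x:{A n..b + real n}|lborel. indicator {..b} x * u r x) \<longlonglongrightarrow> distribution_function r b"
      by (simp add: distribution_function_def set_lebesgue_integral_def)
    moreover have "(LINT x:{A n..b + real n}|lborel. indicator {..b} x * u r x) = (LINT x:{A n..b}|lborel. u r x)" for n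
      unfolding set_lebesgue_integral_def by (rule Bochner_Integration.integral_cong) (auto simp: indicator_def)
    ultimately show ?thesis by simp
  qed
  have "(\<lambda>n. (LINT x:{A n..b}|lborel. u t x) - (LINT x:{A n..b}|lborel. u s x)) \<longlonglongrightarrow>
      distribution_function t b - distribution_function s b"
    by (intro tendsto_diff lim) auto
  moreover have "(\<lambda>n. flux s t (A n) - flux s t b) \<longlonglongrightarrow> 0 - flux s t b"
    by (intro tendsto_intros A(3))
  ultimately show ?thesis
    unfolding transport_interval[OF A(2) st] using LIMSEQ_unique by fastforce
qed

end

section \<open>Level curves and quantiles\<close>

text \<open>\<open>F\<close> does not decrease in time along lines of slope
  \<open>v0 + \<epsilon>\<close> and does not increase along those of slope
  \<open>v0 - \<epsilon>\<close>. The Galois connection turns this into barriers confining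
  \<open>X\<close> to the cone between the two slopes, without inverting \<open>F\<close>.\<close>

lemma level_curve_DERIV:
  fixes F :: "real \<Rightarrow> real \<Rightarrow> real" and X :: "real \<Rightarrow> real"
  assumes "r > 0" and galois: "\<And>t y. \<bar>t - t0\<bar> < r \<Longrightarrow> \<xi> \<le> F t y \<longleftrightarrow> X t \<le> y"
    and up: "\<And>\<epsilon>. \<epsilon> > 0 \<Longrightarrow> \<exists>\<delta>>0. \<forall>p s t. \<bar>p - X t0\<bar> < \<delta> \<longrightarrow> t0 - \<delta> < s \<longrightarrow> s \<le> t \<longrightarrow> t < t0 + \<delta> \<longrightarrow>
      F s (p + (v0 + \<epsilon>) * (s - t0)) \<le> F t (p + (v0 + \<epsilon>) * (t - t0))"
    and down: "\<And>\<epsilon>. \<epsilon> > 0 \<Longrightarrow> \<exists>\<delta>>0. \<forall>p s t. \<bar>p - X t0\<bar> < \<delta> \<longrightarrow> t0 - \<delta> < s \<longrightarrow> s \<le> t \<longrightarrow> t < t0 + \<delta> \<longrightarrow>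
      F t (p + (v0 - \<epsilon>) * (t - t0)) \<le> F s (p + (v0 - \<epsilon>) * (s - t0))"
  shows "(X has_real_derivative v0) (at t0)"
proof -
  have "\<exists>\<delta>>0. \<forall>t. t \<noteq> t0 \<and> \<bar>t - t0\<bar> < \<delta> \<longrightarrow> \<bar>(X t - X t0) / (t - t0) - v0\<bar> < e" if "e > 0" for e
  proof -
    define \<epsilon> where "\<epsilon> = e / 2"
    have "\<epsilon> > 0" using that by (simp add: \<epsilon>_def)
    from up[OF this] obtain \<delta>1 where \<delta>1: "\<delta>1 > 0" and up': "\<And>p s t. \<bar>p - X t0\<bar> < \<delta>1 \<Longrightarrow> t0 - \<delta>1 < s \<Longrightarrow>
        s \<le> t \<Longrightarrow> t < t0 + \<delta>1 \<Longrightarrow> F s (p + (v0 + \<epsilon>) * (s - t0)) \<le> F t (p + (v0 + \<epsilon>) * (t - t0))"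
      by blast
    from down[OF \<open>\<epsilon> > 0\<close>] obtain \<delta>2 where \<delta>2: "\<delta>2 > 0" and down': "\<And>p s t. \<bar>p - X t0\<bar> < \<delta>2 \<Longrightarrow> t0 - \<delta>2 < s \<Longrightarrow>
        s \<le> t \<Longrightarrow> t < t0 + \<delta>2 \<Longrightarrow> F t (p + (v0 - \<epsilon>) * (t - t0)) \<le> F s (p + (v0 - \<epsilon>) * (s - t0))"
      by blast
    define \<delta> where "\<delta> = min r (min \<delta>1 \<delta>2)"
    have \<delta>: "\<delta> > 0" "\<delta> \<le> r" "\<delta> \<le> \<delta>1" "\<delta> \<le> \<delta>2"
      using \<delta>1 \<delta>2 \<open>r > 0\<close> by (auto simp: \<delta>_def)
    have start: "\<xi> \<le> F t0 (X t0)"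
      using galois[of t0 "X t0"] \<open>r > 0\<close> by simp
    have start': "X t0 \<le> p" if "\<xi> \<le> F t0 p" for p
      using galois[of t0 p] \<open>r > 0\<close> that by simp
    have "\<bar>X t - X t0 - v0 * (t - t0)\<bar> \<le> \<epsilon> * \<bar>t - t0\<bar>" if t: "\<bar>t - t0\<bar> < \<delta>" for t
    proof -
      have below: "X t \<le> y" if "\<xi> \<le> F t y" for y
        using galois[of t y] that t \<delta> by simp
      \<comment> \<open>The lower barrier is the slower line at later times and the faster one at
        earlier times. In both cases \<open>w * (t - t0)\<close> equals
        \<open>v0 * (t - t0) - \<epsilon> * \<bar>t - t0\<bar>\<close>.\<close>
      define w where "w = (if t0 \<le> t then v0 - \<epsilon> else v0 + \<epsilon>)"
      \<comment> \<open>Start on the curve and follow a line along which \<open>F\<close> cannot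
        drop below \<open>\<xi>\<close>: the faster one forward in time, the slower one
        backward.\<close>
      have upper: "X t \<le> X t0 + v0 * (t - t0) + \<epsilon> * \<bar>t - t0\<bar>"
      proof (cases "t0 \<le> t")
        case True
        then have "F t0 (X t0) \<le> F t (X t0 + (v0 + \<epsilon>) * (t - t0))"
          using up'[of "X t0" t0 t] t \<delta> by (simp add: abs_if split: if_splits)
        with start have "X t \<le> X t0 + (v0 + \<epsilon>) * (t - t0)"
          by (intro below) simp
        with True show ?thesis by (simp add: algebra_simps)
      next
        case False
        then have "F t0 (X t0) \<le> F t (X t0 + (v0 - \<epsilon>) * (t - t0))"
          using down'[of "X t0" t t0] t \<delta> by (simp add: abs_if split: if_splits)
        with start have "X t \<le> X t0 + (v0 - \<epsilon>) * (t - t0)"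
          by (intro below) simp
        with False show ?thesis by (simp add: algebra_simps)
      qed
      have "X t0 + w * (t - t0) \<le> X t"
      proof (rule ccontr)
        assume neg: "\<not> ?thesis"
        \<comment> \<open>A point left of \<open>X t0\<close> whose line of slope \<open>w\<close>
          meets time \<open>t\<close> at or to the right of \<open>X t\<close>. Transporting the
          level back along it gives \<open>\<xi> \<le> F t0 p\<close>, a contradiction; the second
          argument of \<open>max\<close> keeps \<open>p\<close> in the neighbourhood.\<close>
        define p where "p = max (X t - w * (t - t0)) (X t0 - \<delta> / 2)"
        have p: "p < X t0" "\<bar>p - X t0\<bar> < \<delta>"
          using neg \<delta> by (auto simp: p_def max_def abs_if split: if_splits)
        have "X t \<le> p + w * (t - t0)"
          by (simp add: p_def max_def)
        then have "\<xi> \<le> F t (p + w * (t - t0))"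
          using galois[of t] t \<delta> by simp
        also have "\<dots> \<le> F t0 p"
        proof (cases "t0 \<le> t")
          case True
          then show ?thesis
            using down'[of p t0 t] p t \<delta> by (simp add: w_def)
        next
          case False
          then show ?thesis
            using up'[of p t t0] p t \<delta> by (simp add: w_def)
        qed
        finally show False
          using start'[of p] p by simp
      qed
      with upper show ?thesis
        by (auto simp: w_def abs_if algebra_simps split: if_splits)
    qed
    then have "\<bar>(X t - X t0) / (t - t0) - v0\<bar> < e" if t: "t \<noteq> t0" "\<bar>t - t0\<bar> < \<delta>" for t
    proof -
      have "\<bar>(X t - X t0) / (t - t0) - v0\<bar> = \<bar>X t - X t0 - v0 * (t - t0)\<bar> / \<bar>t - t0\<bar>"
        using t(1) by (simp add: abs_divide[symmetric] diff_divide_distrib)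
      also have "\<dots> \<le> \<epsilon>"
        using \<open>\<And>t. \<bar>t - t0\<bar> < \<delta> \<Longrightarrow> \<bar>X t - X t0 - v0 * (t - t0)\<bar> \<le> \<epsilon> * \<bar>t - t0\<bar>\<close>[OF t(2)] t(1)
        by (simp add: pos_divide_le_eq)
      also have "\<epsilon> < e" using that \<open>e > 0\<close> by (simp add: \<epsilon>_def)
      finally show ?thesis .
    qed
    with \<delta>(1) show ?thesis by blast
  qed
  then have "((\<lambda>t. (X t - X t0) / (t - t0)) \<longlongrightarrow> v0) (at t0)"
    by (intro LIM_I) (auto simp: dist_real_def)
  then show ?thesis
    by (simp add: has_field_derivative_iff)
qed

section \<open>Differentiability of the distribution function and its level curves\<close>

context mass_transport
begin

lemma continuous_V_interior: "continuous_on ({0<..<T} \<times> UNIV) (\<lambda>(t, x). V t x)"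
  unfolding continuous_on_sequentially
proof (intro allI ballI impI)
  fix p :: "nat \<Rightarrow> real \<times> real" and a
  assume a: "a \<in> {0<..<T} \<times> UNIV" "(\<forall>n. p n \<in> {0<..<T} \<times> UNIV) \<and> p \<longlonglongrightarrow> a"
  then have "(\<lambda>n. V (fst (p n)) (snd (p n))) \<longlonglongrightarrow> V (fst a) (snd a)"
    by (intro V_tendsto good_interior tendsto_fst tendsto_snd) (auto simp: mem_Times_iff)
  then show "((\<lambda>(t, x). V t x) \<circ> p) \<longlonglongrightarrow> (\<lambda>(t, x). V t x) a"
    by (simp add: o_def case_prod_beta')
qed

text \<open>Near \<open>b\<close> the function is a constant plus an integral starting at
  \<open>b - 1\<close>, which brings the fundamental theorem of calculus on a compact interval into
  play.\<close>

lemma distribution_function_DERIV_space: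
  assumes "t \<in> {0<..<T}"
  shows "(distribution_function t has_real_derivative u t b) (at b)"
proof -
  have split: "distribution_function t y = distribution_function t (b - 1) + integral {b - 1..y} (u t)"
    if "b - 1 \<le> y" for y
  proof -
    have int: "integrable lborel (\<lambda>x. indicator S x * u t x)" if "S \<in> sets borel" for S
      using integrable_mult_indicator[of S lborel "u t"] good_integrable[OF good_interior[OF assms]] that by simp
    have "distribution_function t y - distribution_function t (b - 1) =
        (LINT x|lborel. indicator {..y} x * u t x - indicator {..b - 1} x * u t x)"
      unfolding distribution_function_def set_lebesgue_integral_def real_scaleR_def
      by (rule Bochner_Integration.integral_diff[symmetric]) (intro int; simp)+
    also have "\<dots> = (LINT x|lborel. indicator {b - 1..y} x * u t x)"
    proof (rule integral_cong_AE)
      show "AE x in lborel. indicator {..y} x * u t x - indicator {..b - 1} x * u t x = indicator {b - 1..y} x * u t x"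
        using AE_lborel_singleton[of "b - 1"] by eventually_elim (use that in \<open>auto simp: indicator_def\<close>)
    qed measurable
    also have "\<dots> = integral {b - 1..y} (u t)"
      using set_borel_integral_eq_integral(2)[OF u_set_integrable, of "b - 1" y t]
      by (simp add: set_lebesgue_integral_def)
    finally show ?thesis by simp
  qed
  have "((\<lambda>y. integral {b - 1..y} (u t)) has_real_derivative u t b) (at b within {b - 1..b + 1})"
    by (intro integral_has_real_derivative continuous_u_compose continuous_intros) auto
  then have "((\<lambda>y. distribution_function t (b - 1) + integral {b - 1..y} (u t)) has_real_derivative u t b) (at b)"
    by (subst (asm) at_within_interior) (auto intro!: derivative_eq_intros)
  moreover have "\<forall>\<^sub>F y in nhds b. distribution_function t y = distribution_function t (b - 1) + integral {b - 1..y} (u t)"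
  proof (rule eventually_mono)
    show "\<forall>\<^sub>F y in nhds b. y \<in> {b - 1<..}"
      by (intro eventually_nhds_in_open) auto
  qed (intro split; simp)
  ultimately show ?thesis
    by (simp add: DERIV_cong_ev)
qed

text \<open>\<open>distribution_function_diff\<close> gives a constant minus an integral of a
  continuous flux. The midpoints \<open>s\<close> and \<open>s'\<close> keep \<open>t\<close>
  interior to a compact subinterval of \<open>{0<..<T}\<close>.\<close>

lemma distribution_function_DERIV_time:
  assumes t: "t \<in> {0<..<T}"
  shows "((\<lambda>r. distribution_function r b) has_real_derivative - (u t b * V t b)) (at t)"
proof -
  define s where "s = t / 2"
  define s' where "s' = (t + T) / 2"
  have s: "0 < s" "s < t" "t < s'" "s' < T"
    using t by (auto simp: s_def s'_def)
  have V: "continuous_on {s..s'} (\<lambda>r. V r b)"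
  proof -
    have "continuous_on {s..s'} (\<lambda>r. (r, b))"
      by (intro continuous_intros)
    moreover have "(\<lambda>r. (r, b)) ` {s..s'} \<subseteq> {0<..<T} \<times> UNIV"
      using s by auto
    ultimately show ?thesis
      using continuous_on_compose2[OF continuous_V_interior, of "{s..s'}" "\<lambda>r. (r, b)"] by simp
  qed
  have cont: "continuous_on {s..s'} (\<lambda>r. u r b * V r b)"
    by (intro continuous_on_mult V continuous_u_compose continuous_intros)
  have split: "distribution_function r b = distribution_function s b - integral {s..r} (\<lambda>r. u r b * V r b)"
    if "s \<le> r" "r \<le> s'" for r
  proof -
    have "flux s r b = integral {s..r} (\<lambda>r. u r b * V r b)"
      unfolding flux_def
      by (intro set_borel_integral_eq_integral(2) flux_integrable) (use s that in auto)
    then show ?thesis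
      using distribution_function_diff[of s r b] s that by simp
  qed
  have "((\<lambda>r. integral {s..r} (\<lambda>r. u r b * V r b)) has_real_derivative u t b * V t b) (at t within {s..s'})"
    by (intro integral_has_real_derivative cont) (use s in auto)
  then have "((\<lambda>r. distribution_function s b - integral {s..r} (\<lambda>r. u r b * V r b)) has_real_derivative
      - (u t b * V t b)) (at t)"
    using s by (subst (asm) at_within_interior) (auto intro!: derivative_eq_intros)
  moreover have "\<forall>\<^sub>F r in nhds t. distribution_function r b = distribution_function s b - integral {s..r} (\<lambda>r. u r b * V r b)"
  proof (rule eventually_mono)
    show "\<forall>\<^sub>F r in nhds t. r \<in> {s<..<s'}"
      using s by (intro eventually_nhds_in_open) auto
  qed (intro split; simp)
  ultimately show ?thesis
    by (simp add: DERIV_cong_ev)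
qed

text \<open>Total differentiability follows from the two partial derivatives and joint continuity of
  the spatial one; the chain rule then gives \<open>- u V + v u\<close>. Its sign is controlled by
  \<open>v - V\<close> because \<open>u\<close> is nonnegative.\<close>

lemma distribution_function_DERIV_line:
  assumes t: "t \<in> {0<..<T}"
  shows "((\<lambda>r. distribution_function r (p + v * (r - t0))) has_real_derivative
    u t (p + v * (t - t0)) * (v - V t (p + v * (t - t0)))) (at t)"
proof -
  define y where "y = p + v * (t - t0)"
  have "((\<lambda>(r, y). distribution_function r y) has_derivative
      (\<lambda>(h, k). - (u t y * V t y) * h + blinfun_scaleR_left (u t y) k)) (at (t, y) within {0<..<T} \<times> UNIV)"
  proof (rule has_derivative_partialsI)
    show "((\<lambda>r. distribution_function r y) has_derivative (*) (- (u t y * V t y))) (at t within {0<..<T})"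
      using distribution_function_DERIV_time[OF t, of y]
      by (simp add: has_field_derivative_def has_derivative_at_withinI)
    show "(distribution_function r has_derivative blinfun_scaleR_left (u r z)) (at z within UNIV)"
      if "r \<in> {0<..<T}" for r z
      using distribution_function_DERIV_space[OF that, of z] unfolding has_field_derivative_def
      by (rule has_derivative_eq_rhs) (simp add: fun_eq_iff)
    have "continuous_on UNIV (\<lambda>z. blinfun_scaleR_left (u (fst z) (snd z)))"
      by (intro bounded_linear.continuous_on[OF bounded_linear_blinfun_scaleR_left] continuous_u_compose
          continuous_intros)
    then show "continuous (at (t, y) within {0<..<T} \<times> UNIV) (\<lambda>(r, z). blinfun_scaleR_left (u r z))"
      by (simp add: case_prod_beta' continuous_on_eq_continuous_at continuous_at_imp_continuous_at_within)
  qed auto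
  then have "((\<lambda>(r, y). distribution_function r y) has_derivative
      (\<lambda>(h, k). - (u t y * V t y) * h + k * u t y)) (at (t, y))"
    using t by (subst (asm) at_within_open) (auto intro!: open_Times)
  moreover have "((\<lambda>r. (r, p + v * (r - t0))) has_derivative (\<lambda>h. (h, v * h))) (at t)"
    by (auto intro!: derivative_eq_intros)
  ultimately have "((\<lambda>r. distribution_function r (p + v * (r - t0))) has_derivative
      (\<lambda>h. - (u t y * V t y) * h + (v * h) * u t y)) (at t)"
    using has_derivative_compose[of "\<lambda>r. (r, p + v * (r - t0))" "\<lambda>h. (h, v * h)" t UNIV
        "\<lambda>(r, y). distribution_function r y"
        "\<lambda>(h, k). - (u t y * V t y) * h + k * u t y"] by (simp add: y_def)
  then show ?thesis
    unfolding has_field_derivative_def y_def[symmetric]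
    by (rule has_derivative_eq_rhs) (auto simp: fun_eq_iff algebra_simps)
qed

lemma V_near:
  assumes t0: "t0 \<in> {0<..<T}" and "\<epsilon> > 0"
  obtains \<delta> where "\<delta> > 0" "\<delta> \<le> t0" "\<delta> \<le> T - t0"
    "\<And>p t. \<bar>p - x0\<bar> < \<delta> \<Longrightarrow> \<bar>t - t0\<bar> < \<delta> \<Longrightarrow> \<bar>V t (p + v * (t - t0)) - V t0 x0\<bar> < \<epsilon>"
proof -
  have "isCont (\<lambda>(t, x). V t x) (t0, x0)"
    using continuous_V_interior t0 by (subst (asm) continuous_on_eq_continuous_at) (auto intro: open_Times)
  then obtain d where d: "d > 0" "\<And>z. dist z (t0, x0) < d \<Longrightarrow> \<bar>(\<lambda>(t, x). V t x) z - (\<lambda>(t, x). V t x) (t0, x0)\<bar> < \<epsilon>"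
    using \<open>\<epsilon> > 0\<close> unfolding continuous_at_eps_delta dist_real_def by blast
  \<comment> \<open>Along the line the distance to \<open>(t0, x0)\<close> is less than
    \<open>\<delta> * (2 + \<bar>v\<bar>)\<close>; the other two bounds keep the times inside
    \<open>{0<..<T}\<close>.\<close>
  define \<delta> where "\<delta> = min (d / (2 + \<bar>v\<bar>)) (min t0 (T - t0))"
  show ?thesis
  proof (rule that)
    show "\<delta> > 0" "\<delta> \<le> t0" "\<delta> \<le> T - t0"
      using d(1) t0 by (auto simp: \<delta>_def divide_pos_pos)
    fix p t assume p: "\<bar>p - x0\<bar> < \<delta>" and t: "\<bar>t - t0\<bar> < \<delta>"
    have "dist (t, p + v * (t - t0)) (t0, x0) \<le> \<bar>t - t0\<bar> + \<bar>p + v * (t - t0) - x0\<bar>"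
      unfolding dist_Pair_Pair dist_real_def by (rule order_trans[OF sqrt_sum_squares_le_sum_abs]) simp
    also have "\<dots> \<le> \<bar>t - t0\<bar> + (\<bar>p - x0\<bar> + \<bar>v\<bar> * \<bar>t - t0\<bar>)"
      unfolding abs_mult[symmetric] by linarith
    also have "\<dots> < \<delta> + (\<delta> + \<bar>v\<bar> * \<delta>)"
      using p t by (intro add_less_le_mono add_mono mult_left_mono) auto
    also have "\<dots> = \<delta> * (2 + \<bar>v\<bar>)"
      by (simp add: algebra_simps)
    also have "\<dots> \<le> d"
      by (simp add: \<delta>_def pos_le_divide_eq[symmetric])
    finally show "\<bar>V t (p + v * (t - t0)) - V t0 x0\<bar> < \<epsilon>"
      using d(2)[of "(t, p + v * (t - t0))"] by simp
  qed
qed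

text \<open>On lines of slope \<open>V t0 (X t0) \<plusminus> \<epsilon>\<close> the difference
  \<open>v - V\<close> keeps its sign near the base point, so \<open>F\<close> is monotone along
  them; zeros of the density only make this monotonicity weak.\<close>

lemma level_curve_DERIV_V:
  assumes t0: "t0 \<in> {0<..<T}"
    and galois: "\<And>t y. t \<in> {0<..<T} \<Longrightarrow> \<xi> \<le> distribution_function t y \<longleftrightarrow> X t \<le> y"
  shows "(X has_real_derivative V t0 (X t0)) (at t0)"
proof (rule level_curve_DERIV)
  show "min t0 (T - t0) > 0" using t0 by simp
  show "\<xi> \<le> distribution_function t y \<longleftrightarrow> X t \<le> y" if "\<bar>t - t0\<bar> < min t0 (T - t0)" for t y
    using that by (intro galois) (auto simp: abs_if split: if_splits)
  fix \<epsilon> :: real assume e: "\<epsilon> > 0"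
  show "\<exists>\<delta>>0. \<forall>p s t. \<bar>p - X t0\<bar> < \<delta> \<longrightarrow> t0 - \<delta> < s \<longrightarrow> s \<le> t \<longrightarrow> t < t0 + \<delta> \<longrightarrow>
      distribution_function s (p + (V t0 (X t0) + \<epsilon>) * (s - t0)) \<le>
      distribution_function t (p + (V t0 (X t0) + \<epsilon>) * (t - t0))"
  proof -
    obtain \<delta> where d: "\<delta> > 0" "\<delta> \<le> t0" "\<delta> \<le> T - t0"
      "\<And>p t. \<bar>p - X t0\<bar> < \<delta> \<Longrightarrow> \<bar>t - t0\<bar> < \<delta> \<Longrightarrow>
        \<bar>V t (p + (V t0 (X t0) + \<epsilon>) * (t - t0)) - V t0 (X t0)\<bar> < \<epsilon>"
      using V_near[OF t0 e] by blast
    show ?thesis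
    proof (intro exI[of _ \<delta>] conjI allI impI d(1))
      fix p s t assume p: "\<bar>p - X t0\<bar> < \<delta>" and st: "t0 - \<delta> < s" "s \<le> t" "t < t0 + \<delta>"
      show "distribution_function s (p + (V t0 (X t0) + \<epsilon>) * (s - t0)) \<le>
          distribution_function t (p + (V t0 (X t0) + \<epsilon>) * (t - t0))"
      proof (rule DERIV_nonneg_imp_nondecreasing[OF st(2)])
        fix r assume "s \<le> r" "r \<le> t"
        with st d have r: "r \<in> {0<..<T}" "\<bar>r - t0\<bar> < \<delta>" by auto
        have "0 \<le> u r (p + (V t0 (X t0) + \<epsilon>) * (r - t0)) *
            (V t0 (X t0) + \<epsilon> - V r (p + (V t0 (X t0) + \<epsilon>) * (r - t0)))"
          by (intro mult_nonneg_nonneg u_nonneg) (use d(4)[OF p r(2)] in linarith)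
        with distribution_function_DERIV_line[OF r(1)]
        show "\<exists>y. ((\<lambda>r. distribution_function r (p + (V t0 (X t0) + \<epsilon>) * (r - t0))) has_real_derivative y) (at r) \<and> 0 \<le> y"
          by blast
      qed
    qed
  qed
  show "\<exists>\<delta>>0. \<forall>p s t. \<bar>p - X t0\<bar> < \<delta> \<longrightarrow> t0 - \<delta> < s \<longrightarrow> s \<le> t \<longrightarrow> t < t0 + \<delta> \<longrightarrow>
      distribution_function t (p + (V t0 (X t0) - \<epsilon>) * (t - t0)) \<le>
      distribution_function s (p + (V t0 (X t0) - \<epsilon>) * (s - t0))"
  proof -
    obtain \<delta> where d: "\<delta> > 0" "\<delta> \<le> t0" "\<delta> \<le> T - t0"
      "\<And>p t. \<bar>p - X t0\<bar> < \<delta> \<Longrightarrow> \<bar>t - t0\<bar> < \<delta> \<Longrightarrow>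
        \<bar>V t (p + (V t0 (X t0) - \<epsilon>) * (t - t0)) - V t0 (X t0)\<bar> < \<epsilon>"
      using V_near[OF t0 e] by blast
    show ?thesis
    proof (intro exI[of _ \<delta>] conjI allI impI d(1))
      fix p s t assume p: "\<bar>p - X t0\<bar> < \<delta>" and st: "t0 - \<delta> < s" "s \<le> t" "t < t0 + \<delta>"
      show "distribution_function t (p + (V t0 (X t0) - \<epsilon>) * (t - t0)) \<le>
          distribution_function s (p + (V t0 (X t0) - \<epsilon>) * (s - t0))"
      proof (rule DERIV_nonpos_imp_nonincreasing[OF st(2)])
        fix r assume "s \<le> r" "r \<le> t"
        with st d have r: "r \<in> {0<..<T}" "\<bar>r - t0\<bar> < \<delta>" by auto
        have "u r (p + (V t0 (X t0) - \<epsilon>) * (r - t0)) *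
            (V t0 (X t0) - \<epsilon> - V r (p + (V t0 (X t0) - \<epsilon>) * (r - t0))) \<le> 0"
          by (intro mult_nonneg_nonpos u_nonneg) (use d(4)[OF p r(2)] in linarith)
        with distribution_function_DERIV_line[OF r(1)]
        show "\<exists>y. ((\<lambda>r. distribution_function r (p + (V t0 (X t0) - \<epsilon>) * (r - t0))) has_real_derivative y) (at r) \<and> y \<le> 0"
          by blast
      qed
    qed
  qed
qed

section \<open>The quantile transformation\<close>

text \<open>Gives access to the pseudoinverse of a distribution function: its Galois connection, its
  measurability and the law it carries.\<close>

lemma cdf_distribution_density:
  assumes "t \<in> {0<..<T}"
  shows "cdf_distribution (density lborel (\<lambda>x. ennreal (u t x)))"
proof -
  have "good t" by (rule good_interior[OF assms])
  then have "(\<integral>\<^sup>+ x. ennreal (u t x) \<partial>lborel) = 1"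
    using nn_integral_eq_integral[OF good_integrable, of t] u_nonneg good_integral by simp
  then have "emeasure (density lborel (\<lambda>x. ennreal (u t x))) UNIV = 1"
    by (subst emeasure_density) (auto intro: measurable_lborel1)
  then show ?thesis
    by (auto simp: cdf_distribution_def real_distribution_def real_distribution_axioms_def intro: prob_spaceI)
qed

lemma cdf_density:
  assumes "t \<in> {0<..<T}"
  shows "cdf (density lborel (\<lambda>x. ennreal (u t x))) = distribution_function t"
proof
  fix b
  have "integrable lborel (\<lambda>x. indicator {..b} x * u t x)"
    using integrable_mult_indicator[of "{..b}" lborel "u t"] good_integrable[OF good_interior[OF assms]] by simp
  from nn_integral_eq_integral[OF this] u_nonneg
  have "(\<integral>\<^sup>+ x. ennreal (indicator {..b} x * u t x) \<partial>lborel) = ennreal (distribution_function t b)"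
    by (simp add: distribution_function_def set_lebesgue_integral_def)
  moreover have "emeasure (density lborel (\<lambda>x. ennreal (u t x))) {..b} =
      (\<integral>\<^sup>+ x. ennreal (indicator {..b} x * u t x) \<partial>lborel)"
    by (subst emeasure_density) (auto simp: indicator_def intro!: nn_integral_cong)
  moreover have "0 \<le> distribution_function t b"
    unfolding distribution_function_def set_lebesgue_integral_def using u_nonneg by (intro integral_nonneg_AE) simp
  ultimately show "cdf (density lborel (\<lambda>x. ennreal (u t x))) b = distribution_function t b"
    by (simp add: cdf_def measure_def)
qed

lemma quantile_le_iff:
  assumes "t \<in> {0<..<T}" "\<xi> \<in> {0<..<1}"
  shows "\<xi> \<le> distribution_function t y \<longleftrightarrow> quantile (distribution_function t) \<xi> \<le> y"
proof -
  interpret cdf_distribution "density lborel (\<lambda>x. ennreal (u t x))"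
    by (rule cdf_distribution_density[OF assms(1)])
  show ?thesis
    using pseudoinverse[of \<xi> y] assms(2) by (simp add: cdf_density[OF assms(1)] quantile_def)
qed

lemma quantile_measurable:
  assumes "t \<in> {0<..<T}"
  shows "quantile (distribution_function t) \<in> borel_measurable (restrict_space lborel {0<..<1})"
proof -
  interpret cdf_distribution "density lborel (\<lambda>x. ennreal (u t x))"
    by (rule cdf_distribution_density[OF assms])
  show ?thesis
    using measurable_CI unfolding cdf_density[OF assms] quantile_def[abs_def]
    by (simp cong: measurable_cong_sets sets_restrict_space_cong)
qed

lemma distr_quantile:
  assumes "t \<in> {0<..<T}"
  shows "distr (restrict_space lborel {0<..<1}) borel (quantile (distribution_function t)) =
    density lborel (\<lambda>x. ennreal (u t x))"
proof -
  interpret cdf_distribution "density lborel (\<lambda>x. ennreal (u t x))"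
    by (rule cdf_distribution_density[OF assms])
  show ?thesis
    using distr_I_eq_M unfolding cdf_density[OF assms] quantile_def[abs_def] .
qed

text \<open>The law of the quantile function has a density, so preimages of null sets are null. This
  allows replacing the interaction function by a Borel representative under the integral over
  \<open>z\<close>.\<close>

lemma AE_quantile:
  assumes t: "t \<in> {0<..<T}" and P: "AE y in lborel. P y"
  shows "AE z in lborel. z \<in> {0<..<1} \<longrightarrow> P (quantile (distribution_function t) z)"
proof -
  have "AE y in lborel. 0 < ennreal (u t y) \<longrightarrow> P y"
    using P by eventually_elim simp
  then have "AE y in density lborel (\<lambda>x. ennreal (u t x)). P y"
    by (simp add: AE_density)
  then have "AE y in distr (restrict_space lborel {0<..<1}) borel (quantile (distribution_function t)). P y"
    by (simp only: distr_quantile[OF t])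
  from AE_distrD[OF quantile_measurable[OF t] this] show ?thesis
    by (simp add: AE_restrict_space_iff)
qed

lemma Psi_quantile_measurable:
  assumes t: "t \<in> {0<..<T}"
  shows "(\<lambda>z. indicator {0<..<1} z * \<Psi> (x - quantile (distribution_function t) z)) \<in> borel_measurable lborel"
proof -
  have "(\<lambda>z. \<Psi> (x - quantile (distribution_function t) z)) \<in> borel_measurable (restrict_space lborel {0<..<1})"
    using quantile_measurable[OF t] by measurable
  then show ?thesis
    by (simp add: borel_measurable_restrict_space_iff)
qed

lemma integral_Psi_quantile:
  assumes t: "t \<in> {0<..<T}"
  shows "(LINT z|lborel. indicator {0<..<1} z * \<Psi> (x - quantile (distribution_function t) z)) = V t x"
proof -
  have "(LINT z|lborel. indicator {0<..<1} z * \<Psi> (x - quantile (distribution_function t) z)) =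
      (LINT z|restrict_space lborel {0<..<1}. \<Psi> (x - quantile (distribution_function t) z))"
    by (simp add: integral_restrict_space)
  also have "\<dots> = (LINT y|density lborel (\<lambda>x. ennreal (u t x)). \<Psi> (x - y))"
    unfolding distr_quantile[OF t, symmetric]
    by (rule integral_distr[symmetric, OF quantile_measurable[OF t]]) measurable
  also have "\<dots> = (LINT y|lborel. u t y *\<^sub>R \<Psi> (x - y))"
    by (rule integral_density) (use u_nonneg in auto)
  finally show ?thesis
    by (simp add: drift_def mult.commute)
qed

end

section \<open>From the distributional formulation to the mass balance\<close>

text \<open>Rests on the completeness of Lebesgue measure.\<close>

lemma measurable_lebesgue_cong_AE:
  fixes f g :: "real \<Rightarrow> real"
  assumes ae: "AE x in lborel. f x = g x" and g: "g \<in> borel_measurable lborel"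
  shows "f \<in> borel_measurable lebesgue"
  unfolding borel_measurable_lebesgue_preimage_borel
proof (intro allI impI)
  fix S :: "real set" assume S: "S \<in> sets borel"
  show "{x. f x \<in> S} \<in> sets lebesgue"
  proof (rule completion.in_sets_AE)
    show "AE x in lebesgue. x \<in> {x. g x \<in> S} \<longleftrightarrow> x \<in> {x. f x \<in> S}"
      using AE_completion[OF ae] by eventually_elim simp
    have "g -` S \<inter> space lborel \<in> sets lborel"
      using g S by (rule measurable_sets)
    then show "{x. g x \<in> S} \<in> sets lebesgue"
      by (simp add: vimage_def)
  qed simp
qed

text \<open>Transfers integrals whose integrand is only controlled almost everywhere, such as those
  involving \<Phi>' or the pairing of \<open>g t\<close> with a test function.\<close>

lemma integral_lebesgue_cong_AE:
  fixes f g :: "real \<Rightarrow> real"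
  assumes ae: "AE x in lborel. f x = g x" and g: "g \<in> borel_measurable lborel"
  shows "(LINT x|lebesgue. f x) = (LINT x|lborel. g x)"
proof -
  have "(LINT x|lebesgue. f x) = (LINT x|lebesgue. g x)"
    by (rule integral_cong_AE)
      (use measurable_lebesgue_cong_AE[OF assms] measurable_completion[OF g] AE_completion[OF ae] in auto)
  also have "\<dots> = (LINT x|lborel. g x)"
    by (rule integral_completion[OF g])
  finally show ?thesis .
qed

lemma AE_lborel_reflect:
  fixes x :: real
  assumes "AE z in lborel. P z"
  shows "AE y in lborel. P (x - y)"
proof -
  obtain N where N: "{z \<in> space lborel. \<not> P z} \<subseteq> N" "N \<in> sets lborel" "emeasure lborel N = 0"
    using AE_E[OF assms] by blast
  then have "N \<in> null_sets lborel" by (auto simp: null_sets_def)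
  then have "AE z in lborel. z \<notin> N" by (rule AE_not_in)
  then have "AE y in lborel. x + - 1 * y \<notin> N"
    using N(2) by (intro AE_borel_affine) auto
  then show ?thesis
    by (rule eventually_mono) (use N(1) in auto)
qed

text \<open>The endpoints are null, so almost-everywhere claims reduce to interior times, where
  two-sided neighbourhoods are available.\<close>

lemma AE_lebesgue_on_Icc_iff:
  "(AE t in lebesgue_on {a..b}. P t) \<longleftrightarrow> (AE t in lborel. t \<in> {a<..<b} \<longrightarrow> P t)" for a b :: real
proof -
  have "(AE t in lebesgue_on {a..b}. P t) \<longleftrightarrow> (AE t in lborel. t \<in> {a..b} \<longrightarrow> P t)"
    by (simp add: AE_restrict_space_iff AE_completion_iff)
  also have "\<dots> \<longleftrightarrow> (AE t in lborel. t \<in> {a<..<b} \<longrightarrow> P t)"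
  proof
    assume "AE t in lborel. t \<in> {a<..<b} \<longrightarrow> P t"
    with AE_lborel_singleton[of a] AE_lborel_singleton[of b]
    show "AE t in lborel. t \<in> {a..b} \<longrightarrow> P t"
      by eventually_elim auto
  qed (erule eventually_mono, auto)
  finally show ?thesis .
qed

lemma test_function_smooth: "\<eta> \<in> test_functions \<Omega> \<Longrightarrow> smooth \<eta>"
  by (simp add: test_functions_def smooth_def)

lemma test_function_eq_0: "\<eta> \<in> test_functions \<Omega> \<Longrightarrow> x \<notin> \<Omega> \<Longrightarrow> \<eta> x = 0"
  unfolding test_functions_def by blast

text \<open>The complement of the compact support is open, so \<eta> vanishes in a whole
  neighbourhood of \<open>x\<close>.\<close>

lemma deriv_test_function_eq_0:
  assumes "\<eta> \<in> test_functions \<Omega>" "x \<notin> \<Omega>"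
  shows "deriv \<eta> x = 0"
proof -
  obtain K where K: "compact K" "K \<subseteq> \<Omega>" "\<And>x. x \<notin> K \<Longrightarrow> \<eta> x = 0"
    using assms(1) unfolding test_functions_def by blast
  have "\<forall>\<^sub>F y in nhds x. y \<in> - K"
    using K assms(2) by (intro eventually_nhds_in_open) (auto intro: compact_imp_closed)
  then have "\<forall>\<^sub>F y in nhds x. \<eta> y = 0"
    by (rule eventually_mono) (use K(3) in auto)
  then have "deriv \<eta> x = deriv (\<lambda>_. 0) x"
    by (rule deriv_cong_ev) simp
  then show ?thesis by simp
qed

text \<open>A negative value at an interior time would persist on a nonempty open subset of the
  strip, which is not a null set.\<close>

lemma continuous_AE_nonneg_imp_nonneg:
  fixes f :: "real \<Rightarrow> real \<Rightarrow> real"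
  assumes cont: "continuous_on ({a..b} \<times> UNIV) (\<lambda>(t, x). f t x)"
    and ae: "AE (t, x) in lebesgue_on ({a..b} \<times> UNIV). 0 \<le> f t x"
    and t: "t \<in> {a<..<b}"
  shows "0 \<le> f t x"
proof (rule ccontr)
  assume neg: "\<not> ?thesis"
  define U where "U = ({a<..<b} \<times> UNIV) \<inter> (\<lambda>(t, x). f t x) -` {..<0}"
  have "open U"
    unfolding U_def
    by (intro continuous_open_preimage continuous_on_subset[OF cont] open_Times) auto
  have "closed ({a..b} \<times> (UNIV :: real set))"
    by (intro closed_Times) auto
  then have "{a..b} \<times> (UNIV :: real set) \<in> sets lebesgue"
    by auto
  then have "AE z in lebesgue. z \<in> {a..b} \<times> UNIV \<longrightarrow> (case z of (t, x) \<Rightarrow> 0 \<le> f t x)"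
    using ae by (simp add: AE_restrict_space_iff)
  then have "AE z in lebesgue. z \<notin> U"
    by (rule eventually_mono) (auto simp: U_def)
  then have "U \<in> null_sets lebesgue"
    using \<open>open U\<close> completion.null_sets_iff_AE[of U lborel] by auto
  then have "negligible U"
    by (simp add: negligible_iff_null_sets)
  moreover have "(t, x) \<in> U"
    using neg t by (simp add: U_def)
  ultimately show False
    using open_not_negligible[OF \<open>open U\<close>] by blast
qed

lemma Linfty_bounded_Borel_representative:
  assumes "f \<in> Linfty"
  obtains \<Psi> C where "\<Psi> \<in> borel_measurable borel" "\<And>z. \<bar>\<Psi> z\<bar> \<le> C" "AE z in lborel. f z = \<Psi> z"
proof -
  obtain C0 where f: "f \<in> borel_measurable lebesgue" and C0: "AE z in lborel. \<bar>f z\<bar> \<le> C0"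
    using assms by (auto simp: Linfty_def AE_completion_iff)
  obtain \<Psi>0 where \<Psi>0: "\<Psi>0 \<in> borel_measurable lborel" "AE z in lborel. f z = \<Psi>0 z"
    using completion_ex_borel_measurable_real[OF f] by blast
  \<comment> \<open>Clipping makes the essential bound hold everywhere; the absolute value of
    \<open>C0\<close> keeps the clipping interval nonempty whatever the sign of
    \<open>C0\<close>.\<close>
  define \<Psi> where "\<Psi> z = max (- \<bar>C0\<bar>) (min \<bar>C0\<bar> (\<Psi>0 z))" for z
  show ?thesis
  proof (rule that)
    show "\<Psi> \<in> borel_measurable borel"
      using \<Psi>0(1) unfolding \<Psi>_def[abs_def] by simp
    show "\<bar>\<Psi> z\<bar> \<le> \<bar>C0\<bar>" for z
      by (auto simp: \<Psi>_def max_def min_def abs_if)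
    show "AE z in lborel. f z = \<Psi> z"
      using C0 \<Psi>0(2) by eventually_elim (auto simp: \<Psi>_def max_def min_def abs_if split: if_splits)
  qed
qed

lemma Lp_norm_1_imp_has_integral:
  assumes "Lp_norm 1 h = 1" "\<And>x. 0 \<le> h x" "h \<in> borel_measurable borel"
  shows "has_bochner_integral lborel h 1"
proof -
  have "Lp_norm 1 h = (LINT x|lborel. h x)"
    using assms(2,3) by (simp add: Lp_norm_def integral_completion)
  with assms(1) have "(LINT x|lborel. h x) = 1" by simp
  \<comment> \<open>A non-integrable function has Bochner integral 0, so the value 1 forces
    integrability.\<close>
  moreover from this have "integrable lborel h"
    using not_integrable_integral_eq by fastforce
  ultimately show ?thesis
    by (simp add: has_bochner_integral_iff)
qed

section \<open>The continuum-limit equation\<close>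

theorem proposition2p2:
  fixes T :: real and k :: nat
    and \<phi> :: "real \<Rightarrow> real \<Rightarrow> real"
    and f0 :: "real \<Rightarrow> real"
    and f F x :: "real \<Rightarrow> real \<Rightarrow> real"
  assumes "T > 0"
    and "A1 k f0"
    and "A2 \<phi>"
    and "solution k T \<phi> f0 f"
    and "AE (t, y) in lebesgue_on ({0..T} \<times> UNIV). f t y > 0"
    and "\<And>t y. t \<in> {0..T} \<Longrightarrow> F t y = cumulative (f t) y"
    and "\<And>t \<xi>. t \<in> {0..T} \<Longrightarrow> \<xi> \<in> {0<..<1} \<Longrightarrow> x t \<xi> = quantile (F t) \<xi>"
  shows "AE t in lebesgue_on {0..T}. \<forall>\<xi>\<in>{0<..<1}.
     ((\<lambda>s. x s \<xi>) has_real_derivative (LINT z:{0<..<1}|lebesgue. \<phi> (x t \<xi>) (x t z)))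
       (at t within {0..T})"
proof -
  obtain \<Phi>' where \<phi>: "\<And>x y. \<phi> x y = \<Phi>' (x - y)" and "\<Phi>' \<in> Linfty"
    using \<open>A2 \<phi>\<close> unfolding A2_def Int_iff by (elim exE conjE) (rule that, simp)
  from this(2) obtain \<Psi> C where \<Psi>: "\<Psi> \<in> borel_measurable borel" "\<And>z. \<bar>\<Psi> z\<bar> \<le> C"
    and \<Phi>'_eq: "AE z in lborel. \<Phi>' z = \<Psi> z"
    by (rule Linfty_bounded_Borel_representative) blast
  from \<open>solution k T \<phi> f0 f\<close> obtain g where
    cont: "continuous_on ({0..T} \<times> UNIV) (\<lambda>(t, x). f t x)" and
    nonneg: "AE (t, x) in lebesgue_on ({0..T} \<times> UNIV). 0 \<le> f t x" and
    mass: "AE t in lebesgue_on {0..T}. Lp_norm 1 (f t) = 1" and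
    time: "has_time_deriv T f g" and
    pde: "AE t in lebesgue_on {0..T}. \<forall>\<eta>\<in>test_functions UNIV.
      distr_of (g t) \<eta> + distr_deriv (distr_of (\<lambda>x. f t x * velocity \<phi> (f t) x)) \<eta> = 0"
    unfolding solution_def by (elim conjE exE) (rule that)
  \<comment> \<open>Freezing time outside \<open>{0..T}\<close> and taking the positive part gives a
    density that is continuous and nonnegative on the whole plane and agrees with \<open>f\<close>
    at interior times.\<close>
  define u where "u t x = max 0 (f (max 0 (min T t)) x)" for t x
  have u_eq: "u t = f t" if "t \<in> {0<..<T}" for t
    using continuous_AE_nonneg_imp_nonneg[OF cont nonneg that] that by (auto simp: u_def fun_eq_iff)
  interpret density_flow C \<Psi> u
  proof
    have "continuous_on UNIV (\<lambda>z. (max 0 (min T (fst z)), snd z) :: real \<times> real)"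
      by (intro continuous_intros)
    moreover have "(\<lambda>z. (max 0 (min T (fst z)), snd z)) ` UNIV \<subseteq> {0..T} \<times> (UNIV :: real set)"
      using \<open>T > 0\<close> by auto
    ultimately have "continuous_on UNIV (\<lambda>z. (\<lambda>(t, x). f t x) (max 0 (min T (fst z)), snd z))"
      by (rule continuous_on_compose2[OF cont])
    then show "continuous_on UNIV (\<lambda>(t, x). u t x)"
      unfolding u_def case_prod_beta' by (intro continuous_intros) simp
  qed (use \<Psi> in \<open>auto simp: u_def\<close>)
  have distr_u: "distr_of (f t) \<zeta> = (LINT x|lborel. u t x * \<zeta> x)"
    if "t \<in> {0<..<T}" "\<zeta> \<in> test_functions UNIV" for t \<zeta>
    unfolding distr_of_def u_eq[OF that(1), symmetric]
    by (intro integral_completion borel_measurable_times u_measurable)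
      (use borel_measurable_smooth[OF test_function_smooth[OF that(2)]] in auto)
  have velocity: "velocity \<phi> (f t) y = V t y" if "t \<in> {0<..<T}" for t y
    unfolding velocity_def drift_def u_eq[OF that, symmetric] \<phi>
  proof (rule integral_lebesgue_cong_AE)
    show "AE z in lborel. \<Phi>' (y - z) * u t z = \<Psi> (y - z) * u t z"
      using AE_lborel_reflect[OF \<Phi>'_eq, of y] by eventually_elim simp
  qed measurable
  interpret mass_transport C \<Psi> u T
  proof
    from mass have "AE t in lborel. t \<in> {0<..<T} \<longrightarrow> Lp_norm 1 (f t) = 1"
      by (simp only: AE_lebesgue_on_Icc_iff)
    then show "AE t in lborel. t \<in> {0<..<T} \<longrightarrow> good t"
    proof eventually_elim
      case (elim t)
      show ?case
      proof
        assume "t \<in> {0<..<T}"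
        with elim have "Lp_norm 1 (u t) = 1"
          by (simp add: u_eq)
        then show "good t"
          unfolding good_def by (rule Lp_norm_1_imp_has_integral[OF _ u_nonneg]) measurable
      qed
    qed
  next
    fix \<zeta> \<eta> assume \<zeta>: "\<zeta> \<in> test_functions UNIV" and \<eta>: "\<eta> \<in> test_functions {0<..<T}"
    have [measurable]: "\<zeta> \<in> borel_measurable borel" "deriv \<zeta> \<in> borel_measurable borel"
      "\<eta> \<in> borel_measurable borel" "deriv \<eta> \<in> borel_measurable borel"
      by (intro borel_measurable_smooth smooth_deriv test_function_smooth[OF \<zeta>] test_function_smooth[OF \<eta>])+
    have "(LINT t|lebesgue_on {0..T}. deriv \<eta> t * distr_of (f t) \<zeta>) =
        (LINT t|lebesgue. indicator {0..T} t * (deriv \<eta> t * distr_of (f t) \<zeta>))"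
      by (simp add: integral_restrict_space)
    also have "\<dots> = (LINT t|lborel. deriv \<eta> t * (LINT x|lborel. u t x * \<zeta> x))"
    proof (rule integral_lebesgue_cong_AE[OF always_eventually[OF allI]])
      fix t
      \<comment> \<open>Outside the open interval both sides vanish with
        \<open>deriv \<eta> t\<close>, so the extension chosen for \<open>u\<close> does not
        enter.\<close>
      show "indicator {0..T} t * (deriv \<eta> t * distr_of (f t) \<zeta>) = deriv \<eta> t * (LINT x|lborel. u t x * \<zeta> x)"
        using distr_u[OF _ \<zeta>, of t] deriv_test_function_eq_0[OF \<eta>, of t]
        by (cases "t \<in> {0<..<T}") auto
    qed measurable
    finally have 1: "(LINT t|lebesgue_on {0..T}. deriv \<eta> t * distr_of (f t) \<zeta>) =
        (LINT t|lborel. deriv \<eta> t * (LINT x|lborel. u t x * \<zeta> x))" .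
    have "(LINT t|lebesgue_on {0..T}. \<eta> t * distr_of (g t) \<zeta>) =
        (LINT t|lebesgue. indicator {0..T} t * (\<eta> t * distr_of (g t) \<zeta>))"
      by (simp add: integral_restrict_space)
    also have "\<dots> = (LINT t|lborel. \<eta> t * (LINT x|lborel. u t x * V t x * deriv \<zeta> x))"
    proof (rule integral_lebesgue_cong_AE)
      from pde have "AE t in lborel. t \<in> {0<..<T} \<longrightarrow> (\<forall>\<eta>\<in>test_functions UNIV.
          distr_of (g t) \<eta> + distr_deriv (distr_of (\<lambda>x. f t x * velocity \<phi> (f t) x)) \<eta> = 0)"
        by (simp only: AE_lebesgue_on_Icc_iff)
      then show "AE t in lborel. indicator {0..T} t * (\<eta> t * distr_of (g t) \<zeta>) =
          \<eta> t * (LINT x|lborel. u t x * V t x * deriv \<zeta> x)"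
      proof eventually_elim
        case (elim t)
        show ?case
        proof (cases "t \<in> {0<..<T}")
          case True
          \<comment> \<open>The equation in \<open>x\<close> trades the time derivative for the
            flux; the sign in \<open>distr_deriv\<close> cancels here, so the pairing is with
            \<open>deriv \<zeta>\<close>.\<close>
          with elim \<zeta> have "distr_of (g t) \<zeta> = distr_of (\<lambda>x. f t x * velocity \<phi> (f t) x) (deriv \<zeta>)"
            by (auto simp: distr_deriv_def)
          also have "\<dots> = (LINT x|lebesgue. u t x * V t x * deriv \<zeta> x)"
            by (simp add: distr_of_def velocity[OF True] u_eq[OF True])
          also have "\<dots> = (LINT x|lborel. u t x * V t x * deriv \<zeta> x)"
            by (rule integral_completion) measurable
          finally show ?thesis using True by simp
        qed (simp add: test_function_eq_0[OF \<eta>])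
      qed
    qed measurable
    finally have 2: "(LINT t|lebesgue_on {0..T}. \<eta> t * distr_of (g t) \<zeta>) =
        (LINT t|lborel. \<eta> t * (LINT x|lborel. u t x * V t x * deriv \<zeta> x))" .
    show "(LINT t|lborel. deriv \<eta> t * (LINT x|lborel. u t x * \<zeta> x)) =
        - (LINT t|lborel. \<eta> t * (LINT x|lborel. u t x * V t x * deriv \<zeta> x))"
      using time[unfolded has_time_deriv_def, rule_format, OF \<zeta> \<eta>] unfolding 1 2 .
  qed
  have F: "F t = distribution_function t" if t: "t \<in> {0<..<T}" for t
  proof
    fix y
    have "F t y = (LINT z|lebesgue. indicator {..y} z * u t z)"
      using assms(6)[of t y] t by (simp add: cumulative_def set_lebesgue_integral_def u_eq[OF t])
    also have "\<dots> = (LINT z|lborel. indicator {..y} z * u t z)"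
      by (rule integral_completion) measurable
    finally show "F t y = distribution_function t y"
      by (simp add: distribution_function_def set_lebesgue_integral_def)
  qed
  have x: "x t \<xi> = quantile (distribution_function t) \<xi>" if "t \<in> {0<..<T}" "\<xi> \<in> {0<..<1}" for t \<xi>
    using assms(7)[of t \<xi>] F[of t] that by simp
  \<comment> \<open>The equation is obtained at every interior time as a two-sided derivative;
    restricting to \<open>{0..T}\<close> and discarding the endpoints happens only at the
    end.\<close>
  have DERIV: "((\<lambda>s. x s \<xi>) has_real_derivative (LINT z:{0<..<1}|lebesgue. \<phi> (x t \<xi>) (x t z))) (at t)"
    if t: "t \<in> {0<..<T}" and \<xi>: "\<xi> \<in> {0<..<1}" for t \<xi>
  proof -
    have "(LINT z:{0<..<1}|lebesgue. \<phi> (x t \<xi>) (x t z)) =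
        (LINT z|lborel. indicator {0<..<1} z * \<Psi> (x t \<xi> - quantile (distribution_function t) z))"
      unfolding set_lebesgue_integral_def real_scaleR_def \<phi>
    proof (rule integral_lebesgue_cong_AE[OF _ Psi_quantile_measurable[OF t]])
      \<comment> \<open>\<Phi>' and \<Psi> differ on a null set. Reflection at
        \<open>x t \<xi>\<close> and the quantile map both pull null sets back to null sets.\<close>
      show "AE z in lborel. indicator {0<..<1} z * \<Phi>' (x t \<xi> - x t z) =
          indicator {0<..<1} z * \<Psi> (x t \<xi> - quantile (distribution_function t) z)"
        using AE_quantile[OF t AE_lborel_reflect[OF \<Phi>'_eq, of "x t \<xi>"]]
        by eventually_elim (auto simp: indicator_def x[OF t])
    qed
    also have "\<dots> = V t (x t \<xi>)"
      by (rule integral_Psi_quantile[OF t])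
    finally have rhs: "(LINT z:{0<..<1}|lebesgue. \<phi> (x t \<xi>) (x t z)) = V t (x t \<xi>)" .
    have "\<xi> \<le> distribution_function s y \<longleftrightarrow> x s \<xi> \<le> y" if "s \<in> {0<..<T}" for s y
      unfolding x[OF that \<xi>] by (rule quantile_le_iff[OF that \<xi>])
    then show ?thesis
      unfolding rhs by (rule level_curve_DERIV_V[OF t])
  qed
  show ?thesis
    unfolding AE_lebesgue_on_Icc_iff
  proof (intro always_eventually allI impI ballI)
    fix t \<xi> :: real assume "t \<in> {0<..<T}" "\<xi> \<in> {0<..<1}"
    then show "((\<lambda>s. x s \<xi>) has_real_derivative (LINT z:{0<..<1}|lebesgue. \<phi> (x t \<xi>) (x t z)))
        (at t within {0..T})"
      by (intro has_field_derivative_at_within[OF DERIV])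
  qed
qed

end
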